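(* Let $(M^{2n+1},\theta,\xi,\eta,g)$ be a nearly cosymplectic manifold. Then for any $X$ in $TM$, we have $$\sum_{i=1}^{2n+1}g(\nabla_{E_i}\xi,R(E_i,X)\xi)=0,$$ where $\{E_i\}_{i=1,\dots,2n+1}=\{F_i\}_{i=1,\dots,2n}\cup\{\xi\}$ is an orthonormal basis of $TM$ with $\{F_i\}_{i=1,\dots,2n}$ an orthonormal basis of $\mathcal F$.
   Context: An almost contact (metric) structure on a Riemannian manifold $(M^{2n+1},g)$ consists of a $(1,1)$-tensor $\theta$, a 1-form $\eta$ and a unit vector field $\xi$ with $\theta^2=-\mathrm{Id}+\eta\otimes\xi$, $\eta(\xi)=1$, compatible with the metric: $g(\theta X,\theta Y)=g(X,Y)-\eta(X)\eta(Y)$ (so $\eta=g(\xi,\cdot)$, $\theta\xi=0$ and $\theta$ is skew-symmetric). It is nearly cosymplectic, and $(M,\theta,\xi,\eta,g)$ is a nearly cosymplectic manifold, if $(\nabla_X\theta)(Y)+(\nabla_Y\theta)(X)=0$ for all $X,Y$, where $\nabla$ is the Levi-Civita connection of $g$. $\mathcal F$ is the distribution orthogonal to $\xi$ (rank $2n$). The curvature is $R(X,Y)=[\nabla_X,\nabla_Y]-\nabla_{[X,Y]}$. *)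

theory Defs
  imports "HOL-Analysis.Analysis"
begin

section \<open>Smooth maps between Euclidean spaces\<close>

text \<open>Only meant for open \<open>S\<close>, where \<open>Ck_on k S f\<close> says that \<open>f\<close> is of class \<open>C^k\<close> on \<open>S\<close>.\<close>

primrec Ck_on :: "nat \<Rightarrow> 'a::euclidean_space set \<Rightarrow> ('a \<Rightarrow> 'b::real_normed_vector) \<Rightarrow> bool" where
  "Ck_on 0 S f \<longleftrightarrow> continuous_on S f"
| "Ck_on (Suc k) S f \<longleftrightarrow> (\<forall>x\<in>S. f differentiable (at x)) \<and>
     (\<forall>v. Ck_on k S (\<lambda>x. frechet_derivative f (at x) v))"

definition smooth_map_on :: "'a::euclidean_space set \<Rightarrow> ('a \<Rightarrow> 'b::real_normed_vector) \<Rightarrow> bool" where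
  "smooth_map_on S f \<longleftrightarrow> (\<forall>k. Ck_on k S f)"


section \<open>Smooth manifolds and smooth functions\<close>

text \<open>The manifold is the whole type \<open>'m\<close>; its dimension is that of the model space \<open>'e\<close>.
  A chart is a pair \<open>(U, \<phi>)\<close> of a domain and a map, relevant on \<open>U\<close> only.
  The atlas need not be maximal. The Hausdorff property and second countability are
  imposed as sort constraints on \<open>'m\<close>.\<close>

type_synonym ('m, 'e) atlas = "('m set \<times> ('m \<Rightarrow> 'e)) set"

definition smooth_atlas :: "('m::topological_space, 'e::euclidean_space) atlas \<Rightarrow> bool" where
  "smooth_atlas A \<longleftrightarrow>
     (\<Union>(U, \<phi>)\<in>A. U) = UNIV \<and>
     (\<forall>(U, \<phi>)\<in>A. open U \<and> open (\<phi> ` U) \<and> homeomorphism U (\<phi> ` U) \<phi> (inv_into U \<phi>)) \<and>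
     (\<forall>(U, \<phi>)\<in>A. \<forall>(V, \<psi>)\<in>A. smooth_map_on (\<phi> ` (U \<inter> V)) (\<psi> \<circ> inv_into U \<phi>))"

text \<open>For open \<open>W\<close>: smoothness on \<open>W\<close> of a function whose values off \<open>W\<close> are irrelevant.\<close>

definition smooth_on :: "('m::topological_space, 'e::euclidean_space) atlas \<Rightarrow> 'm set \<Rightarrow> ('m \<Rightarrow> real) \<Rightarrow> bool" where
  "smooth_on A W f \<longleftrightarrow> (\<forall>(U, \<phi>)\<in>A. smooth_map_on (\<phi> ` (U \<inter> W)) (f \<circ> inv_into U \<phi>))"

definition smooth_near :: "('m::topological_space, 'e::euclidean_space) atlas \<Rightarrow> 'm \<Rightarrow> ('m \<Rightarrow> real) set" where
  "smooth_near A p = {f. \<exists>W. open W \<and> p \<in> W \<and> smooth_on A W f}"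


section \<open>Tangent vectors and vector fields\<close>

text \<open>A tangent vector at \<open>p\<close> is a derivation at \<open>p\<close> of the algebra of germs of smooth functions.
  It is represented by a functional on all functions, so the last clause fixes its
  (meaningless) values on functions that are not smooth near \<open>p\<close>; this makes equality
  of functionals the equality of derivations.\<close>

type_synonym 'm tvec = "('m \<Rightarrow> real) \<Rightarrow> real"
type_synonym 'm vfield = "'m \<Rightarrow> 'm tvec"

definition tangent_space :: "('m::topological_space, 'e::euclidean_space) atlas \<Rightarrow> 'm \<Rightarrow> 'm tvec set" where
  "tangent_space A p = {v.
     (\<forall>f\<in>smooth_near A p. \<forall>h\<in>smooth_near A p. v (\<lambda>q. f q + h q) = v f + v h) \<and>
     (\<forall>c. \<forall>f\<in>smooth_near A p. v (\<lambda>q. c * f q) = c * v f) \<and>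
     (\<forall>f\<in>smooth_near A p. \<forall>h\<in>smooth_near A p. v (\<lambda>q. f q * h q) = v f * h p + f p * v h) \<and>
     (\<forall>f\<in>smooth_near A p. \<forall>h\<in>smooth_near A p. eventually (\<lambda>q. f q = h q) (nhds p) \<longrightarrow> v f = v h) \<and>
     (\<forall>f. f \<notin> smooth_near A p \<longrightarrow> v f = 0)}"

definition tzero :: "'m tvec" where
  "tzero = (\<lambda>f. 0)"

definition tadd :: "'m tvec \<Rightarrow> 'm tvec \<Rightarrow> 'm tvec" where
  "tadd u v = (\<lambda>f. u f + v f)"

definition tsub :: "'m tvec \<Rightarrow> 'm tvec \<Rightarrow> 'm tvec" where
  "tsub u v = (\<lambda>f. u f - v f)"

definition tscale :: "real \<Rightarrow> 'm tvec \<Rightarrow> 'm tvec" where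
  "tscale c v = (\<lambda>f. c * v f)"

text \<open>Smooth vector fields on an open set \<open>W\<close>; values off \<open>W\<close> are irrelevant.\<close>

definition vfield_on :: "('m::topological_space, 'e::euclidean_space) atlas \<Rightarrow> 'm set \<Rightarrow> 'm vfield \<Rightarrow> bool" where
  "vfield_on A W X \<longleftrightarrow> (\<forall>q\<in>W. X q \<in> tangent_space A q) \<and>
     (\<forall>V f. open V \<and> V \<subseteq> W \<and> smooth_on A V f \<longrightarrow> smooth_on A V (\<lambda>q. X q f))"

definition vfields_near :: "('m::topological_space, 'e::euclidean_space) atlas \<Rightarrow> 'm \<Rightarrow> 'm vfield set" where
  "vfields_near A p = {X. \<exists>W. open W \<and> p \<in> W \<and> vfield_on A W X}"

text \<open>The guard keeps the bracket zero on functions not smooth near \<open>p\<close>, as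
  \<^const>\<open>tangent_space\<close> requires.\<close>

definition lie_bracket :: "('m::topological_space, 'e::euclidean_space) atlas \<Rightarrow> 'm vfield \<Rightarrow> 'm vfield \<Rightarrow> 'm vfield" where
  "lie_bracket A X Y p = (\<lambda>f. if f \<in> smooth_near A p
     then X p (\<lambda>q. Y q f) - Y p (\<lambda>q. X q f) else 0)"


section \<open>Riemannian metrics and the Levi-Civita connection\<close>

type_synonym 'm metric = "'m \<Rightarrow> 'm tvec \<Rightarrow> 'm tvec \<Rightarrow> real"

definition riemannian_metric :: "('m::topological_space, 'e::euclidean_space) atlas \<Rightarrow> 'm metric \<Rightarrow> bool" where
  "riemannian_metric A g \<longleftrightarrow>
     (\<forall>p. \<forall>u\<in>tangent_space A p. \<forall>v\<in>tangent_space A p. \<forall>w\<in>tangent_space A p. \<forall>c.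
        g p (tadd u v) w = g p u w + g p v w \<and>
        g p (tscale c u) w = c * g p u w \<and>
        g p u v = g p v u) \<and>
     (\<forall>p. \<forall>u\<in>tangent_space A p. u \<noteq> tzero \<longrightarrow> g p u u > 0) \<and>
     (\<forall>W X Y. open W \<and> vfield_on A W X \<and> vfield_on A W Y \<longrightarrow>
        smooth_on A W (\<lambda>q. g q (X q) (Y q)))"

text \<open>\<open>D p v Y\<close> is the derivative of the field \<open>Y\<close>, defined near \<open>p\<close>, in direction of the
  tangent vector \<open>v\<close> at \<open>p\<close>. Taking a vector rather than a field as direction
  encodes tensoriality in that argument.\<close>

type_synonym 'm connection = "'m \<Rightarrow> 'm tvec \<Rightarrow> 'm vfield \<Rightarrow> 'm tvec"

definition affine_connection :: "('m::topological_space, 'e::euclidean_space) atlas \<Rightarrow> 'm connection \<Rightarrow> bool" where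
  "affine_connection A D \<longleftrightarrow>
     (\<forall>p. \<forall>u\<in>tangent_space A p. \<forall>v\<in>tangent_space A p. \<forall>c.
        \<forall>Y\<in>vfields_near A p. \<forall>Z\<in>vfields_near A p. \<forall>f\<in>smooth_near A p.
        D p v Y \<in> tangent_space A p \<and>
        D p (tadd u v) Y = tadd (D p u Y) (D p v Y) \<and>
        D p (tscale c v) Y = tscale c (D p v Y) \<and>
        D p v (\<lambda>q. tadd (Y q) (Z q)) = tadd (D p v Y) (D p v Z) \<and>
        D p v (\<lambda>q. tscale (f q) (Y q)) = tadd (tscale (v f) (Y p)) (tscale (f p) (D p v Y)) \<and>
        (eventually (\<lambda>q. Y q = Z q) (nhds p) \<longrightarrow> D p v Y = D p v Z)) \<and>
     (\<forall>W X Y. open W \<and> vfield_on A W X \<and> vfield_on A W Y \<longrightarrow>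
        vfield_on A W (\<lambda>q. D q (X q) Y))"

definition levi_civita :: "('m::topological_space, 'e::euclidean_space) atlas \<Rightarrow> 'm metric \<Rightarrow> 'm connection \<Rightarrow> bool" where
  "levi_civita A g D \<longleftrightarrow> affine_connection A D \<and>
     (\<forall>p. \<forall>v\<in>tangent_space A p. \<forall>Y\<in>vfields_near A p. \<forall>Z\<in>vfields_near A p.
        v (\<lambda>q. g q (Y q) (Z q)) = g p (D p v Y) (Z p) + g p (Y p) (D p v Z)) \<and>
     (\<forall>p. \<forall>X\<in>vfields_near A p. \<forall>Y\<in>vfields_near A p.
        tsub (D p (X p) Y) (D p (Y p) X) = lie_bracket A X Y p)"

definition curvature :: "('m::topological_space, 'e::euclidean_space) atlas \<Rightarrow> 'm connection \<Rightarrow>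
    'm vfield \<Rightarrow> 'm vfield \<Rightarrow> 'm vfield \<Rightarrow> 'm vfield" where
  "curvature A D X Y Z p =
     tsub (tsub (D p (X p) (\<lambda>q. D q (Y q) Z)) (D p (Y p) (\<lambda>q. D q (X q) Z)))
          (D p (lie_bracket A X Y p) Z)"

definition orthonormal_basis :: "('m tvec \<Rightarrow> 'm tvec \<Rightarrow> real) \<Rightarrow> 'm tvec set \<Rightarrow> 'i set \<Rightarrow> ('i \<Rightarrow> 'm tvec) \<Rightarrow> bool" where
  "orthonormal_basis b V I e \<longleftrightarrow> finite I \<and> (\<forall>i\<in>I. e i \<in> V) \<and>
     (\<forall>i\<in>I. \<forall>j\<in>I. b (e i) (e j) = (if i = j then 1 else 0)) \<and>
     (\<forall>v\<in>V. \<exists>c. v = (\<lambda>f. \<Sum>i\<in>I. c i * e i f))"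


section \<open>Nearly cosymplectic structures\<close>

type_synonym 'm endo_field = "'m \<Rightarrow> 'm tvec \<Rightarrow> 'm tvec"
type_synonym 'm one_form = "'m \<Rightarrow> 'm tvec \<Rightarrow> real"

definition tensor_11 :: "('m::topological_space, 'e::euclidean_space) atlas \<Rightarrow> 'm endo_field \<Rightarrow> bool" where
  "tensor_11 A \<theta> \<longleftrightarrow>
     (\<forall>p. \<forall>u\<in>tangent_space A p. \<forall>v\<in>tangent_space A p. \<forall>c.
        \<theta> p v \<in> tangent_space A p \<and>
        \<theta> p (tadd u v) = tadd (\<theta> p u) (\<theta> p v) \<and>
        \<theta> p (tscale c v) = tscale c (\<theta> p v)) \<and>
     (\<forall>W X. open W \<and> vfield_on A W X \<longrightarrow> vfield_on A W (\<lambda>q. \<theta> q (X q)))"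

definition smooth_one_form :: "('m::topological_space, 'e::euclidean_space) atlas \<Rightarrow> 'm one_form \<Rightarrow> bool" where
  "smooth_one_form A \<eta> \<longleftrightarrow>
     (\<forall>p. \<forall>u\<in>tangent_space A p. \<forall>v\<in>tangent_space A p. \<forall>c.
        \<eta> p (tadd u v) = \<eta> p u + \<eta> p v \<and>
        \<eta> p (tscale c v) = c * \<eta> p v) \<and>
     (\<forall>W X. open W \<and> vfield_on A W X \<longrightarrow> smooth_on A W (\<lambda>q. \<eta> q (X q)))"

definition almost_contact_metric :: "('m::topological_space, 'e::euclidean_space) atlas \<Rightarrow> 'm endo_field \<Rightarrow>
    'm vfield \<Rightarrow> 'm one_form \<Rightarrow> 'm metric \<Rightarrow> bool" where
  "almost_contact_metric A \<theta> \<xi> \<eta> g \<longleftrightarrow>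
     riemannian_metric A g \<and> tensor_11 A \<theta> \<and> smooth_one_form A \<eta> \<and> vfield_on A UNIV \<xi> \<and>
     (\<forall>p. g p (\<xi> p) (\<xi> p) = 1 \<and> \<eta> p (\<xi> p) = 1) \<and>
     (\<forall>p. \<forall>u\<in>tangent_space A p.
        \<theta> p (\<theta> p u) = tadd (tscale (- 1) u) (tscale (\<eta> p u) (\<xi> p))) \<and>
     (\<forall>p. \<forall>u\<in>tangent_space A p. \<forall>v\<in>tangent_space A p.
        g p (\<theta> p u) (\<theta> p v) = g p u v - \<eta> p u * \<eta> p v)"

definition cov_deriv_11 :: "'m connection \<Rightarrow> 'm endo_field \<Rightarrow> 'm \<Rightarrow> 'm tvec \<Rightarrow> 'm vfield \<Rightarrow> 'm tvec" where
  "cov_deriv_11 D \<theta> p v Y = tsub (D p v (\<lambda>q. \<theta> q (Y q))) (\<theta> p (D p v Y))"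

text \<open>Here \<open>D\<close> is the Levi-Civita connection of \<open>g\<close>, which is unique on tangent vectors
  and fields near the base point.\<close>

definition nearly_cosymplectic :: "('m::topological_space, 'e::euclidean_space) atlas \<Rightarrow> 'm endo_field \<Rightarrow>
    'm vfield \<Rightarrow> 'm one_form \<Rightarrow> 'm metric \<Rightarrow> 'm connection \<Rightarrow> bool" where
  "nearly_cosymplectic A \<theta> \<xi> \<eta> g D \<longleftrightarrow>
     almost_contact_metric A \<theta> \<xi> \<eta> g \<and> levi_civita A g D \<and>
     (\<forall>p. \<forall>X\<in>vfields_near A p. \<forall>Y\<in>vfields_near A p.
        tadd (cov_deriv_11 D \<theta> p (X p) Y) (cov_deriv_11 D \<theta> p (Y p) X) = tzero)"

definition distribution_F :: "('m::topological_space, 'e::euclidean_space) atlas \<Rightarrow> 'm metric \<Rightarrow> 'm vfield \<Rightarrow> 'm \<Rightarrow> 'm tvec set" where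
  "distribution_F A g \<xi> p = {v \<in> tangent_space A p. g p v (\<xi> p) = 0}"

end

theory Submission
  imports Defs
begin

text \<open>The tensor \<open>\<psi>(X,Y,Z) = g((\<nabla>\<^sub>X\<theta>)Y,Z)\<close> is totally skew. The Ricci identity for \<open>\<theta>\<close> and the first
  Bianchi identity then show that \<open>\<theta>\<close> annihilates the trilinear form \<open>R(\<xi>,X,Y,Z)\<close> as a
  derivation, so this form vanishes for \<open>X\<close>, \<open>Y\<close>, \<open>Z\<close> orthogonal to \<open>\<xi>\<close>. Since \<open>\<nabla>\<xi>\<close> is
  skew-symmetric and kills \<open>\<xi>\<close>, the sum reduces to \<open>g(X,\<xi>)\<close> times the trace of the product of the
  symmetric operator \<open>R(_,\<xi>)\<xi>\<close> with \<open>\<nabla>\<xi>\<close>, which is zero.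

  All fields are considered on one open neighbourhood. The curvature \<open>R4 X Y Z V\<close> visibly depends
  on \<open>V\<close> pointwise only, and the curvature symmetries transfer this to the other slots, so
  no extension of tangent vectors and no linearity over functions is needed.\<close>

section \<open>Smooth functions and vector fields\<close>

lemma Ck_on_subset: "Ck_on k S f \<Longrightarrow> T \<subseteq> S \<Longrightarrow> Ck_on k T f"
  by (induction k arbitrary: f) (auto intro: continuous_on_subset)

text \<open>On an open set a pointwise equality also identifies the Frechet derivatives, so the
  induction passes from \<open>f\<close> and \<open>h\<close> to their directional
  derivatives.\<close>

lemma Ck_on_cong:
  assumes "open S" "Ck_on k S f" "\<And>x. x \<in> S \<Longrightarrow> f x = h x"
  shows "Ck_on k S h"
  using assms(2,3)
proof (induction k arbitrary: f h)
  case 0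
  then show ?case by (metis Ck_on.simps(1) continuous_on_eq)
next
  case (Suc k)
  have deriv: "(h has_derivative frechet_derivative f (at x)) (at x)" if "x \<in> S" for x
  proof (rule has_derivative_transform_within_open[OF _ assms(1) that])
    show "(f has_derivative frechet_derivative f (at x)) (at x)"
      using Suc.prems(1) that by (simp add: frechet_derivative_works)
  qed (rule Suc.prems(2))
  have "Ck_on k S (\<lambda>x. frechet_derivative h (at x) v)" for v
  proof (rule Suc.IH)
    show "Ck_on k S (\<lambda>x. frechet_derivative f (at x) v)"
      using Suc.prems(1) by simp
    show "frechet_derivative f (at x) v = frechet_derivative h (at x) v" if "x \<in> S" for x
      using frechet_derivative_at[OF deriv[OF that]] by simp
  qed
  moreover have "h differentiable (at x)" if "x \<in> S" for x
    using deriv[OF that] unfolding differentiable_def by blast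
  ultimately show ?case by simp
qed

lemma Ck_on_diff:
  assumes "open S" "Ck_on k S f" "Ck_on k S h"
  shows "Ck_on k S (\<lambda>x. f x - h x)"
  using assms(2,3)
proof (induction k arbitrary: f h)
  case 0
  then show ?case by (simp add: continuous_on_diff)
next
  case (Suc k)
  have deriv: "((\<lambda>y. f y - h y) has_derivative
      (\<lambda>v. frechet_derivative f (at x) v - frechet_derivative h (at x) v)) (at x)" if "x \<in> S" for x
    using Suc.prems that by (intro has_derivative_diff) (simp_all add: frechet_derivative_works)
  have "Ck_on k S (\<lambda>x. frechet_derivative (\<lambda>y. f y - h y) (at x) v)" for v
  proof (rule Ck_on_cong[OF assms(1)])
    show "Ck_on k S (\<lambda>x. frechet_derivative f (at x) v - frechet_derivative h (at x) v)"
      using Suc.prems by (intro Suc.IH) simp_all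
    show "frechet_derivative f (at x) v - frechet_derivative h (at x) v =
        frechet_derivative (\<lambda>y. f y - h y) (at x) v" if "x \<in> S" for x
      by (subst frechet_derivative_at[OF deriv[OF that], symmetric]) simp
  qed
  moreover have "(\<lambda>y. f y - h y) differentiable (at x)" if "x \<in> S" for x
    using deriv[OF that] unfolding differentiable_def by blast
  ultimately show ?case by simp
qed

section \<open>Smooth functions and vector fields on open subsets of the manifold\<close>

lemma smooth_on_iff:
  "smooth_on A W f \<longleftrightarrow>
    (\<forall>U \<phi> k. (U, \<phi>) \<in> A \<longrightarrow> Ck_on k (\<phi> ` (U \<inter> W)) (f \<circ> inv_into U \<phi>))"
  unfolding smooth_on_def smooth_map_on_def by auto

lemma smooth_on_subset:
  assumes "smooth_on A W f" "V \<subseteq> W"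
  shows "smooth_on A V f"
  unfolding smooth_on_iff
proof (intro allI impI)
  fix U \<phi> k assume "(U, \<phi>) \<in> A"
  then have "Ck_on k (\<phi> ` (U \<inter> W)) (f \<circ> inv_into U \<phi>)"
    using assms(1) by (simp add: smooth_on_iff)
  then show "Ck_on k (\<phi> ` (U \<inter> V)) (f \<circ> inv_into U \<phi>)"
    by (rule Ck_on_subset) (use assms(2) in blast)
qed

lemma smooth_nearI: "smooth_on A W f \<Longrightarrow> open W \<Longrightarrow> p \<in> W \<Longrightarrow> f \<in> smooth_near A p"
  unfolding smooth_near_def by (intro CollectI exI[of _ W] conjI)

lemma vfield_onI:
  assumes "\<And>q. q \<in> W \<Longrightarrow> X q \<in> tangent_space A q"
    and "\<And>V f. open V \<Longrightarrow> V \<subseteq> W \<Longrightarrow> smooth_on A V f \<Longrightarrow> smooth_on A V (\<lambda>q. X q f)"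
  shows "vfield_on A W X"
  unfolding vfield_on_def by (intro conjI ballI allI impI assms) simp_all

lemma vfield_onD: "vfield_on A W X \<Longrightarrow> q \<in> W \<Longrightarrow> X q \<in> tangent_space A q"
  unfolding vfield_on_def by (elim conjE) (rule bspec)

lemma vfield_on_smooth:
  assumes "vfield_on A W X" "open V" "V \<subseteq> W" "smooth_on A V f"
  shows "smooth_on A V (\<lambda>q. X q f)"
proof -
  have "\<forall>V f. open V \<and> V \<subseteq> W \<and> smooth_on A V f \<longrightarrow> smooth_on A V (\<lambda>q. X q f)"
    using assms(1) unfolding vfield_on_def by (rule conjunct2)
  then show ?thesis using assms(2-4) by simp
qed

lemma vfield_on_subset:
  assumes "vfield_on A W X" "V \<subseteq> W"
  shows "vfield_on A V X"
  using vfield_onD[OF assms(1)] vfield_on_smooth[OF assms(1)] assms(2)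
  by (intro vfield_onI) (simp_all add: subset_iff)

lemma vfields_nearI: "vfield_on A W X \<Longrightarrow> open W \<Longrightarrow> p \<in> W \<Longrightarrow> X \<in> vfields_near A p"
  unfolding vfields_near_def by (intro CollectI exI[of _ W] conjI)

lemma atlas_chart:
  assumes "smooth_atlas A" "(U, \<phi>) \<in> A"
  shows "open (\<phi> ` U)" "homeomorphism U (\<phi> ` U) \<phi> (inv_into U \<phi>)"
proof -
  have "\<forall>(U, \<phi>)\<in>A. open U \<and> open (\<phi> ` U) \<and> homeomorphism U (\<phi> ` U) \<phi> (inv_into U \<phi>)"
    using assms(1) unfolding smooth_atlas_def by (elim conjE)
  from bspec[OF this assms(2)]
  show "open (\<phi> ` U)" "homeomorphism U (\<phi> ` U) \<phi> (inv_into U \<phi>)"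
    by simp_all
qed

lemma open_chart_image:
  assumes "smooth_atlas A" "(U, \<phi>) \<in> A" "open W"
  shows "open (\<phi> ` (U \<inter> W))"
proof -
  have "openin (top_of_set (\<phi> ` U)) (\<phi> ` (U \<inter> W))"
    by (intro homeomorphism_imp_open_map[OF atlas_chart(2)[OF assms(1,2)]] openin_open_Int assms(3))
  then show ?thesis
    using atlas_chart(1)[OF assms(1,2)] openin_open_trans by blast
qed

lemma chart_image_inv:
  assumes "smooth_atlas A" "(U, \<phi>) \<in> A" "x \<in> \<phi> ` (U \<inter> W)"
  shows "inv_into U \<phi> x \<in> W"
proof -
  obtain y where y: "y \<in> U" "y \<in> W" "x = \<phi> y"
    using assms(3) by blast
  then show ?thesis
    using homeomorphism_apply1[OF atlas_chart(2)[OF assms(1,2)] y(1)] by simp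
qed

lemma smooth_on_cong:
  assumes "smooth_atlas A" "open W" "smooth_on A W f" "\<And>q. q \<in> W \<Longrightarrow> f q = h q"
  shows "smooth_on A W h"
  unfolding smooth_on_iff
proof (intro allI impI)
  fix U \<phi> k assume U: "(U, \<phi>) \<in> A"
  show "Ck_on k (\<phi> ` (U \<inter> W)) (h \<circ> inv_into U \<phi>)"
  proof (rule Ck_on_cong[OF open_chart_image[OF assms(1) U assms(2)]])
    show "Ck_on k (\<phi> ` (U \<inter> W)) (f \<circ> inv_into U \<phi>)"
      using assms(3) U by (simp add: smooth_on_iff)
    show "(f \<circ> inv_into U \<phi>) x = (h \<circ> inv_into U \<phi>) x" if "x \<in> \<phi> ` (U \<inter> W)" for x
      using assms(4)[OF chart_image_inv[OF assms(1) U that]] by simp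
  qed
qed

lemma smooth_on_diff:
  assumes "smooth_atlas A" "open W" "smooth_on A W f" "smooth_on A W h"
  shows "smooth_on A W (\<lambda>q. f q - h q)"
  unfolding smooth_on_iff
proof (intro allI impI)
  fix U \<phi> k assume U: "(U, \<phi>) \<in> A"
  have "Ck_on k (\<phi> ` (U \<inter> W)) (f \<circ> inv_into U \<phi>)" "Ck_on k (\<phi> ` (U \<inter> W)) (h \<circ> inv_into U \<phi>)"
    using assms(3,4) U by (simp_all add: smooth_on_iff)
  from Ck_on_diff[OF open_chart_image[OF assms(1) U assms(2)] this]
  show "Ck_on k (\<phi> ` (U \<inter> W)) ((\<lambda>q. f q - h q) \<circ> inv_into U \<phi>)"
    by (simp add: o_def)
qed

lemma vfield_on_cong:
  assumes "smooth_atlas A" "vfield_on A W X" "\<And>q. q \<in> W \<Longrightarrow> X q = Y q"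
  shows "vfield_on A W Y"
proof (rule vfield_onI)
  show "Y q \<in> tangent_space A q" if "q \<in> W" for q
    using vfield_onD[OF assms(2) that] assms(3)[OF that] by simp
  fix V f assume V: "open V" "V \<subseteq> W" "smooth_on A V f"
  show "smooth_on A V (\<lambda>q. Y q f)"
  proof (rule smooth_on_cong[OF assms(1) V(1) vfield_on_smooth[OF assms(2) V]])
    show "X q f = Y q f" if "q \<in> V" for q
      using assms(3) that V(2) by (simp add: subset_iff)
  qed
qed

section \<open>The vector space of derivations at a point\<close>

lemma tangent_add:
  "v \<in> tangent_space A p \<Longrightarrow> f \<in> smooth_near A p \<Longrightarrow> h \<in> smooth_near A p \<Longrightarrow>
    v (\<lambda>q. f q + h q) = v f + v h"
  unfolding tangent_space_def by blast

lemma tangent_scale: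
  "v \<in> tangent_space A p \<Longrightarrow> f \<in> smooth_near A p \<Longrightarrow> v (\<lambda>q. c * f q) = c * v f"
  unfolding tangent_space_def by blast

lemma tangent_mult:
  "v \<in> tangent_space A p \<Longrightarrow> f \<in> smooth_near A p \<Longrightarrow> h \<in> smooth_near A p \<Longrightarrow>
    v (\<lambda>q. f q * h q) = v f * h p + f p * v h"
  unfolding tangent_space_def by blast

lemma tangent_cong:
  "v \<in> tangent_space A p \<Longrightarrow> f \<in> smooth_near A p \<Longrightarrow> h \<in> smooth_near A p \<Longrightarrow>
    eventually (\<lambda>q. f q = h q) (nhds p) \<Longrightarrow> v f = v h"
  unfolding tangent_space_def by blast

lemma tangent_nonsmooth: "v \<in> tangent_space A p \<Longrightarrow> f \<notin> smooth_near A p \<Longrightarrow> v f = 0"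
  unfolding tangent_space_def by blast

lemma tadd_tangent [intro]:
  assumes u: "u \<in> tangent_space A p" and v: "v \<in> tangent_space A p"
  shows "tadd u v \<in> tangent_space A p"
  unfolding tangent_space_def mem_Collect_eq tadd_def
proof (intro conjI ballI allI impI)
  fix f h assume fh: "f \<in> smooth_near A p" "h \<in> smooth_near A p"
  show "u (\<lambda>q. f q + h q) + v (\<lambda>q. f q + h q) = u f + v f + (u h + v h)"
    by (simp add: tangent_add[OF u fh] tangent_add[OF v fh])
  show "u (\<lambda>q. f q * h q) + v (\<lambda>q. f q * h q) = (u f + v f) * h p + f p * (u h + v h)"
    by (simp add: tangent_mult[OF u fh] tangent_mult[OF v fh] algebra_simps)
  show "u f + v f = u h + v h" if "eventually (\<lambda>q. f q = h q) (nhds p)"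
    using tangent_cong[OF u fh that] tangent_cong[OF v fh that] by simp
next
  fix c f assume f: "f \<in> smooth_near A p"
  show "u (\<lambda>q. c * f q) + v (\<lambda>q. c * f q) = c * (u f + v f)"
    by (simp add: tangent_scale[OF u f] tangent_scale[OF v f] algebra_simps)
next
  fix f assume f: "f \<notin> smooth_near A p"
  show "u f + v f = 0"
    by (simp add: tangent_nonsmooth[OF u f] tangent_nonsmooth[OF v f])
qed

lemma tscale_tangent [intro]:
  assumes v: "v \<in> tangent_space A p"
  shows "tscale c v \<in> tangent_space A p"
  unfolding tangent_space_def mem_Collect_eq tscale_def
proof (intro conjI ballI allI impI)
  fix f h assume fh: "f \<in> smooth_near A p" "h \<in> smooth_near A p"
  show "c * v (\<lambda>q. f q + h q) = c * v f + c * v h"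
    by (simp add: tangent_add[OF v fh] algebra_simps)
  show "c * v (\<lambda>q. f q * h q) = c * v f * h p + f p * (c * v h)"
    by (simp add: tangent_mult[OF v fh] algebra_simps)
  show "c * v f = c * v h" if "eventually (\<lambda>q. f q = h q) (nhds p)"
    using tangent_cong[OF v fh that] by simp
next
  fix a f assume f: "f \<in> smooth_near A p"
  show "c * v (\<lambda>q. a * f q) = a * (c * v f)"
    by (simp add: tangent_scale[OF v f])
next
  fix f assume f: "f \<notin> smooth_near A p"
  show "c * v f = 0"
    by (simp add: tangent_nonsmooth[OF v f])
qed

lemma tsub_eq: "tsub u v = tadd u (tscale (- 1) v)"
  by (auto simp: tsub_def tadd_def tscale_def)

lemma tsub_tangent [intro]:
  "u \<in> tangent_space A p \<Longrightarrow> v \<in> tangent_space A p \<Longrightarrow> tsub u v \<in> tangent_space A p"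
  unfolding tsub_eq by auto

lemma tzero_tangent [intro]: "v \<in> tangent_space A p \<Longrightarrow> tzero \<in> tangent_space A p"
  using tsub_tangent[of v A p v] by (simp add: tsub_def tzero_def)

lemma vfield_on_diff:
  assumes "smooth_atlas A" "vfield_on A W X" "vfield_on A W Y"
  shows "vfield_on A W (\<lambda>q. tsub (X q) (Y q))"
proof (rule vfield_onI)
  show "tsub (X q) (Y q) \<in> tangent_space A q" if "q \<in> W" for q
    using assms that by (intro tsub_tangent vfield_onD)
  show "smooth_on A V (\<lambda>q. tsub (X q) (Y q) f)"
    if "open V" "V \<subseteq> W" "smooth_on A V f" for V f
    unfolding tsub_def
    by (rule smooth_on_diff[OF assms(1) that(1) vfield_on_smooth[OF assms(2) that]
          vfield_on_smooth[OF assms(3) that]])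
qed

section \<open>Connection and metric on an open set\<close>

text \<open>The open set \<open>W\<close> stays abstract, so that the neighbourhoods of the
  individual fields are shrunk to a common one only once, in the theorem.\<close>

locale nearly_cosymplectic_on =
  fixes A :: "('m::topological_space, 'e::euclidean_space) atlas"
    and \<theta> :: "'m endo_field" and \<xi> :: "'m vfield" and \<eta> :: "'m one_form"
    and g :: "'m metric" and D :: "'m connection" and W :: "'m set"
  assumes atlas: "smooth_atlas A"
    and nearly_cosymplectic: "nearly_cosymplectic A \<theta> \<xi> \<eta> g D"
    and open_W: "open W"
begin

abbreviation vf :: "'m vfield \<Rightarrow> bool" where "vf X \<equiv> vfield_on A W X"
abbreviation T :: "'m \<Rightarrow> 'm tvec set" where "T q \<equiv> tangent_space A q"
abbreviation ip :: "'m vfield \<Rightarrow> 'm vfield \<Rightarrow> 'm \<Rightarrow> real" where "ip X Y \<equiv> \<lambda>q. g q (X q) (Y q)"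
abbreviation nab :: "'m vfield \<Rightarrow> 'm vfield \<Rightarrow> 'm vfield" where "nab X Y \<equiv> \<lambda>q. D q (X q) Y"
abbreviation th :: "'m vfield \<Rightarrow> 'm vfield" where "th X \<equiv> \<lambda>q. \<theta> q (X q)"
abbreviation br :: "'m vfield \<Rightarrow> 'm vfield \<Rightarrow> 'm vfield" where "br X Y \<equiv> lie_bracket A X Y"

lemma structure_facts:
  shows riemannian: "riemannian_metric A g" and tensor: "tensor_11 A \<theta>"
    and xi_UNIV: "vfield_on A UNIV \<xi>"
    and unit: "\<forall>p. g p (\<xi> p) (\<xi> p) = 1 \<and> \<eta> p (\<xi> p) = 1"
    and square: "\<forall>p. \<forall>u\<in>T p. \<theta> p (\<theta> p u) = tadd (tscale (- 1) u) (tscale (\<eta> p u) (\<xi> p))"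
    and compatible: "\<forall>p. \<forall>u\<in>T p. \<forall>v\<in>T p. g p (\<theta> p u) (\<theta> p v) = g p u v - \<eta> p u * \<eta> p v"
    and connection: "affine_connection A D" and levi_civita: "levi_civita A g D"
    and nearly: "\<forall>p. \<forall>X\<in>vfields_near A p. \<forall>Y\<in>vfields_near A p.
        tadd (cov_deriv_11 D \<theta> p (X p) Y) (cov_deriv_11 D \<theta> p (Y p) X) = tzero"
proof -
  have ac: "almost_contact_metric A \<theta> \<xi> \<eta> g" and lc: "levi_civita A g D"
    and nr: "\<forall>p. \<forall>X\<in>vfields_near A p. \<forall>Y\<in>vfields_near A p.
        tadd (cov_deriv_11 D \<theta> p (X p) Y) (cov_deriv_11 D \<theta> p (Y p) X) = tzero"
    using nearly_cosymplectic unfolding nearly_cosymplectic_def by - (elim conjE, assumption)+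
  show "levi_civita A g D" by (fact lc)
  show "\<forall>p. \<forall>X\<in>vfields_near A p. \<forall>Y\<in>vfields_near A p.
        tadd (cov_deriv_11 D \<theta> p (X p) Y) (cov_deriv_11 D \<theta> p (Y p) X) = tzero"
    by (fact nr)
  show "affine_connection A D"
    using lc unfolding levi_civita_def by (rule conjunct1)
  show "riemannian_metric A g" "tensor_11 A \<theta>" "vfield_on A UNIV \<xi>"
    "\<forall>p. g p (\<xi> p) (\<xi> p) = 1 \<and> \<eta> p (\<xi> p) = 1"
    "\<forall>p. \<forall>u\<in>T p. \<theta> p (\<theta> p u) = tadd (tscale (- 1) u) (tscale (\<eta> p u) (\<xi> p))"
    "\<forall>p. \<forall>u\<in>T p. \<forall>v\<in>T p. g p (\<theta> p u) (\<theta> p v) = g p u v - \<eta> p u * \<eta> p v"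
    using ac unfolding almost_contact_metric_def by - (elim conjE, assumption)+
qed

section \<open>Bilinearity, symmetry and definiteness of the metric\<close>

lemma metric_clause:
  assumes "u \<in> T q" "v \<in> T q" "w \<in> T q"
  shows "g q (tadd u v) w = g q u w + g q v w \<and> g q (tscale c u) w = c * g q u w \<and> g q u v = g q v u"
proof -
  have "\<forall>p. \<forall>u\<in>T p. \<forall>v\<in>T p. \<forall>w\<in>T p. \<forall>c.
      g p (tadd u v) w = g p u w + g p v w \<and> g p (tscale c u) w = c * g p u w \<and> g p u v = g p v u"
    using riemannian unfolding riemannian_metric_def by (rule conjunct1)
  from bspec[OF bspec[OF bspec[OF spec[OF this] assms(1)] assms(2)] assms(3), THEN spec, of c]
  show ?thesis .
qed

lemma g_sym: "u \<in> T q \<Longrightarrow> v \<in> T q \<Longrightarrow> g q u v = g q v u"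
  using metric_clause[of u q v v] by simp

lemma g_add_left: "u \<in> T q \<Longrightarrow> v \<in> T q \<Longrightarrow> w \<in> T q \<Longrightarrow> g q (tadd u v) w = g q u w + g q v w"
  using metric_clause[of u q v w] by simp

lemma g_scale_left: "u \<in> T q \<Longrightarrow> w \<in> T q \<Longrightarrow> g q (tscale c u) w = c * g q u w"
  using metric_clause[of u q w w c] by simp

lemma g_sub_left: "u \<in> T q \<Longrightarrow> v \<in> T q \<Longrightarrow> w \<in> T q \<Longrightarrow> g q (tsub u v) w = g q u w - g q v w"
  by (simp add: tsub_eq g_add_left g_scale_left tscale_tangent)

lemma g_add_right: "u \<in> T q \<Longrightarrow> v \<in> T q \<Longrightarrow> w \<in> T q \<Longrightarrow> g q w (tadd u v) = g q w u + g q w v"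
  by (simp add: g_sym[of w] g_add_left tadd_tangent)

lemma g_scale_right: "u \<in> T q \<Longrightarrow> w \<in> T q \<Longrightarrow> g q w (tscale c u) = c * g q w u"
  by (simp add: g_sym[of w] g_scale_left tscale_tangent)

lemma g_sub_right: "u \<in> T q \<Longrightarrow> v \<in> T q \<Longrightarrow> w \<in> T q \<Longrightarrow> g q w (tsub u v) = g q w u - g q w v"
  by (simp add: g_sym[of w] g_sub_left tsub_tangent)

lemma g_zero_left: "u \<in> T q \<Longrightarrow> g q tzero u = 0"
  using g_scale_left[of u q u 0] by (simp add: tscale_def tzero_def)

lemma g_zero_right: "u \<in> T q \<Longrightarrow> g q u tzero = 0"
  using g_scale_right[of u q u 0] by (simp add: tscale_def tzero_def)

lemma g_definite:
  assumes "u \<in> T q" "g q u u = 0"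
  shows "u = tzero"
proof (rule ccontr)
  assume "u \<noteq> tzero"
  have "\<forall>p. \<forall>u\<in>T p. u \<noteq> tzero \<longrightarrow> g p u u > 0"
    using riemannian unfolding riemannian_metric_def by (elim conjE)
  then show False
    using \<open>u \<noteq> tzero\<close> assms by (metis less_irrefl)
qed

lemma ip_smooth:
  assumes "vf X" "vf Y"
  shows "smooth_on A W (ip X Y)"
proof -
  have "\<forall>W X Y. open W \<and> vfield_on A W X \<and> vfield_on A W Y \<longrightarrow> smooth_on A W (ip X Y)"
    using riemannian unfolding riemannian_metric_def by (elim conjE)
  from this[rule_format, of W X Y] show ?thesis using assms open_W by simp
qed

section \<open>The Reeb field and the pointwise algebra of the structure tensor\<close>

lemma xi_vf: "vf \<xi>"
  by (rule vfield_on_subset[OF xi_UNIV]) simp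

lemma xi_tangent: "\<xi> q \<in> T q"
  by (rule vfield_onD[OF xi_UNIV]) simp

lemma xi_unit: "g q (\<xi> q) (\<xi> q) = 1"
  using unit by simp

lemma tensor_clause:
  assumes "u \<in> T q" "v \<in> T q"
  shows "\<theta> q v \<in> T q \<and> \<theta> q (tadd u v) = tadd (\<theta> q u) (\<theta> q v) \<and> \<theta> q (tscale c v) = tscale c (\<theta> q v)"
proof -
  have "\<forall>p. \<forall>u\<in>T p. \<forall>v\<in>T p. \<forall>c. \<theta> p v \<in> T p \<and>
      \<theta> p (tadd u v) = tadd (\<theta> p u) (\<theta> p v) \<and> \<theta> p (tscale c v) = tscale c (\<theta> p v)"
    using tensor unfolding tensor_11_def by (rule conjunct1)
  from bspec[OF bspec[OF spec[OF this] assms(1)] assms(2), THEN spec, of c]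
  show ?thesis .
qed

lemma theta_tangent: "u \<in> T q \<Longrightarrow> \<theta> q u \<in> T q"
  using tensor_clause[of u q u] by simp

lemma theta_add: "u \<in> T q \<Longrightarrow> v \<in> T q \<Longrightarrow> \<theta> q (tadd u v) = tadd (\<theta> q u) (\<theta> q v)"
  using tensor_clause[of u q v] by simp

lemma theta_scale: "u \<in> T q \<Longrightarrow> \<theta> q (tscale c u) = tscale c (\<theta> q u)"
  using tensor_clause[of u q u c] by simp

lemma th_vf:
  assumes "vf X"
  shows "vf (th X)"
proof -
  have "\<forall>W X. open W \<and> vfield_on A W X \<longrightarrow> vfield_on A W (th X)"
    using tensor unfolding tensor_11_def by (rule conjunct2)
  from this[rule_format, of W X] show ?thesis using assms open_W by simp
qed

lemma theta_metric: "u \<in> T q \<Longrightarrow> v \<in> T q \<Longrightarrow> g q (\<theta> q u) (\<theta> q v) = g q u v - \<eta> q u * \<eta> q v"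
  using compatible by simp

lemma theta_square: "u \<in> T q \<Longrightarrow> \<theta> q (\<theta> q u) = tadd (tscale (- 1) u) (tscale (\<eta> q u) (\<xi> q))"
  using square by simp

lemma theta_xi: "\<theta> q (\<xi> q) = tzero"
proof (rule g_definite)
  show "\<theta> q (\<xi> q) \<in> T q" by (intro theta_tangent xi_tangent)
  show "g q (\<theta> q (\<xi> q)) (\<theta> q (\<xi> q)) = 0"
    using theta_metric[OF xi_tangent xi_tangent, of q] unit by simp
qed

lemma eta_eq: "u \<in> T q \<Longrightarrow> \<eta> q u = g q u (\<xi> q)"
  using theta_metric[of u q "\<xi> q"] g_zero_right[OF theta_tangent, of u q] unit
  by (simp add: xi_tangent theta_xi)

lemma theta_theta: "u \<in> T q \<Longrightarrow> \<theta> q (\<theta> q u) = tadd (tscale (- 1) u) (tscale (g q u (\<xi> q)) (\<xi> q))"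
  by (simp add: theta_square eta_eq)

lemma theta_cube:
  assumes "u \<in> T q"
  shows "\<theta> q (\<theta> q (\<theta> q u)) = tscale (- 1) (\<theta> q u)"
proof -
  have "\<theta> q (\<theta> q (\<theta> q u)) = tadd (tscale (- 1) (\<theta> q u)) (tscale (g q u (\<xi> q)) tzero)"
    unfolding theta_theta[OF assms]
    by (simp add: theta_add theta_scale assms xi_tangent tscale_tangent theta_xi)
  then show ?thesis by (simp add: tadd_def tscale_def tzero_def)
qed

text \<open>Reading the cube of \<theta> as \<theta>^2 applied to \<theta> u produces a term
  g(\<theta> u, \<xi>) \<xi> that is absent from \<open>theta_cube\<close>, hence zero.\<close>

lemma theta_perp_xi:
  assumes "u \<in> T q"
  shows "g q (\<theta> q u) (\<xi> q) = 0"
proof -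
  have "tscale (g q (\<theta> q u) (\<xi> q)) (\<xi> q) = tzero"
    using theta_theta[OF theta_tangent[OF assms]] theta_cube[OF assms]
    by (simp add: fun_eq_iff tadd_def tscale_def tzero_def)
  then have "g q (tscale (g q (\<theta> q u) (\<xi> q)) (\<xi> q)) (\<xi> q) = 0"
    by (simp add: g_zero_left xi_tangent)
  then show ?thesis
    by (simp add: g_scale_left xi_tangent xi_unit)
qed

text \<open>Compatibility for the pair \<theta> u, v removes one \<theta> from each argument;
  expanding \<theta>^2 u instead gives the other side.\<close>

lemma theta_skew:
  assumes "u \<in> T q" "v \<in> T q"
  shows "g q (\<theta> q u) v = - g q u (\<theta> q v)"
proof -
  have "g q (\<theta> q (\<theta> q u)) (\<theta> q v) = g q (\<theta> q u) v"
    using theta_metric[OF theta_tangent[OF assms(1)] assms(2)] assms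
    by (simp add: eta_eq theta_tangent theta_perp_xi)
  then show ?thesis
    unfolding theta_theta[OF assms(1)]
    using theta_perp_xi[OF assms(2)] g_sym[OF xi_tangent theta_tangent[OF assms(2)]]
    by (simp add: g_add_left g_scale_left theta_tangent tscale_tangent xi_tangent assms)
qed

section \<open>Calculus of the Levi-Civita connection on \<open>W\<close>\<close>

lemma vf_near: "vf X \<Longrightarrow> q \<in> W \<Longrightarrow> X \<in> vfields_near A q"
  by (rule vfields_nearI[OF _ open_W])

lemma smooth_near: "smooth_on A W f \<Longrightarrow> q \<in> W \<Longrightarrow> f \<in> smooth_near A q"
  by (rule smooth_nearI[OF _ open_W])

lemma eventually_W: "q \<in> W \<Longrightarrow> (\<And>r. r \<in> W \<Longrightarrow> P r) \<Longrightarrow> eventually P (nhds q)"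
  using open_W by (auto simp: eventually_nhds)

lemma connection_clause:
  assumes "q \<in> W" "u \<in> T q" "v \<in> T q" "vf Y" "vf Z"
  shows "D q v Y \<in> T q \<and> D q (tadd u v) Y = tadd (D q u Y) (D q v Y) \<and>
    D q (tscale c v) Y = tscale c (D q v Y) \<and>
    D q v (\<lambda>q. tadd (Y q) (Z q)) = tadd (D q v Y) (D q v Z) \<and>
    (eventually (\<lambda>q. Y q = Z q) (nhds q) \<longrightarrow> D q v Y = D q v Z)"
proof -
  have "\<forall>p. \<forall>u\<in>T p. \<forall>v\<in>T p. \<forall>c.
        \<forall>Y\<in>vfields_near A p. \<forall>Z\<in>vfields_near A p. \<forall>f\<in>smooth_near A p.
        D p v Y \<in> T p \<and>
        D p (tadd u v) Y = tadd (D p u Y) (D p v Y) \<and>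
        D p (tscale c v) Y = tscale c (D p v Y) \<and>
        D p v (\<lambda>q. tadd (Y q) (Z q)) = tadd (D p v Y) (D p v Z) \<and>
        D p v (\<lambda>q. tscale (f q) (Y q)) = tadd (tscale (v f) (Y p)) (tscale (f p) (D p v Y)) \<and>
        (eventually (\<lambda>q. Y q = Z q) (nhds p) \<longrightarrow> D p v Y = D p v Z)"
    using connection unfolding affine_connection_def by (rule conjunct1)
  \<comment> \<open>The quantified function needs some smooth instance; the function
    \<open>ip \<xi> \<xi>\<close>, constantly 1, is one at hand.\<close>
  from bspec[OF bspec[OF bspec[OF spec[OF bspec[OF bspec[OF spec[OF this] assms(2)] assms(3)], of c]
      vf_near[OF assms(4,1)]] vf_near[OF assms(5,1)]] smooth_near[OF ip_smooth[OF xi_vf xi_vf] assms(1)]]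
  show ?thesis by (elim conjE) (intro conjI)
qed

lemma D_tangent: "q \<in> W \<Longrightarrow> v \<in> T q \<Longrightarrow> vf Y \<Longrightarrow> D q v Y \<in> T q"
  using connection_clause[of q v v Y Y] by simp

lemma D_dir_add: "q \<in> W \<Longrightarrow> u \<in> T q \<Longrightarrow> v \<in> T q \<Longrightarrow> vf Y \<Longrightarrow>
    D q (tadd u v) Y = tadd (D q u Y) (D q v Y)"
  using connection_clause[of q u v Y Y] by simp

lemma D_dir_scale: "q \<in> W \<Longrightarrow> v \<in> T q \<Longrightarrow> vf Y \<Longrightarrow> D q (tscale c v) Y = tscale c (D q v Y)"
  using connection_clause[of q v v Y Y c] by simp

lemma D_dir_sub: "q \<in> W \<Longrightarrow> u \<in> T q \<Longrightarrow> v \<in> T q \<Longrightarrow> vf Y \<Longrightarrow>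
    D q (tsub u v) Y = tsub (D q u Y) (D q v Y)"
  by (simp add: tsub_eq D_dir_add D_dir_scale tscale_tangent)

lemma D_add: "q \<in> W \<Longrightarrow> v \<in> T q \<Longrightarrow> vf Y \<Longrightarrow> vf Z \<Longrightarrow>
    D q v (\<lambda>r. tadd (Y r) (Z r)) = tadd (D q v Y) (D q v Z)"
  using connection_clause[of q v v Y Z] by simp

lemma D_cong:
  assumes "q \<in> W" "v \<in> T q" "vf Y" "\<And>r. r \<in> W \<Longrightarrow> Y r = Z r"
  shows "D q v Y = D q v Z"
proof -
  have "vf Z" by (rule vfield_on_cong[OF atlas assms(3,4)])
  moreover have "eventually (\<lambda>r. Y r = Z r) (nhds q)"
    by (rule eventually_W[OF assms(1,4)])
  ultimately show ?thesis
    using connection_clause[OF assms(1,2,2,3), of Z] by simp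
qed

lemma vf_sub: "vf Y \<Longrightarrow> vf Z \<Longrightarrow> vf (\<lambda>r. tsub (Y r) (Z r))"
  by (rule vfield_on_diff[OF atlas])

text \<open>Additivity is applied to Y = (Y - Z) + Z.\<close>

lemma D_sub:
  assumes "q \<in> W" "v \<in> T q" "vf Y" "vf Z"
  shows "D q v (\<lambda>r. tsub (Y r) (Z r)) = tsub (D q v Y) (D q v Z)"
proof -
  have "(\<lambda>r. tadd (tsub (Y r) (Z r)) (Z r)) = Y"
    by (simp add: tadd_def tsub_def fun_eq_iff)
  then have "D q v Y = tadd (D q v (\<lambda>r. tsub (Y r) (Z r))) (D q v Z)"
    using D_add[OF assms(1,2) vf_sub[OF assms(3,4)] assms(4)] by simp
  then show ?thesis
    by (simp add: tadd_def tsub_def fun_eq_iff)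
qed

lemma D_zero:
  assumes "q \<in> W" "v \<in> T q" "\<And>r. r \<in> W \<Longrightarrow> Y r = tzero"
  shows "D q v Y = tzero"
proof -
  have "D q v (\<lambda>r. tsub (\<xi> r) (\<xi> r)) = D q v Y"
    by (rule D_cong[OF assms(1,2) vf_sub[OF xi_vf xi_vf]]) (simp add: assms(3) tsub_def tzero_def)
  then show ?thesis
    unfolding D_sub[OF assms(1,2) xi_vf xi_vf] by (simp add: tsub_def tzero_def)
qed

text \<open>Writing -Y as (Y - Y) - Y reduces the claim to two uses of \<open>D_sub\<close>.\<close>

lemma D_minus:
  assumes "q \<in> W" "v \<in> T q" "vf Y" "\<And>r. r \<in> W \<Longrightarrow> Z r = tscale (- 1) (Y r)"
  shows "D q v Z = tscale (- 1) (D q v Y)"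
proof -
  note vf0 = vf_sub[OF assms(3,3)]
  have "D q v (\<lambda>r. tsub (tsub (Y r) (Y r)) (Y r)) = D q v Z"
    by (rule D_cong[OF assms(1,2) vf_sub[OF vf0 assms(3)]])
      (simp add: assms(4) tsub_def tscale_def)
  then show ?thesis
    unfolding D_sub[OF assms(1,2) vf0 assms(3)] D_sub[OF assms(1,2,3,3)]
    by (auto simp: tsub_def tscale_def)
qed

lemma nab_vf:
  assumes "vf X" "vf Y"
  shows "vf (nab X Y)"
proof -
  have "\<forall>W X Y. open W \<and> vfield_on A W X \<and> vfield_on A W Y \<longrightarrow> vfield_on A W (nab X Y)"
    using connection unfolding affine_connection_def by (rule conjunct2)
  from this[rule_format, of W X Y] show ?thesis using assms open_W by simp
qed

lemma D_metric:
  assumes "q \<in> W" "v \<in> T q" "vf Y" "vf Z"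
  shows "v (ip Y Z) = g q (D q v Y) (Z q) + g q (Y q) (D q v Z)"
proof -
  have "\<forall>p. \<forall>v\<in>T p. \<forall>Y\<in>vfields_near A p. \<forall>Z\<in>vfields_near A p.
        v (\<lambda>q. g q (Y q) (Z q)) = g p (D p v Y) (Z p) + g p (Y p) (D p v Z)"
    using levi_civita unfolding levi_civita_def by (elim conjE)
  from bspec[OF bspec[OF bspec[OF spec[OF this] assms(2)] vf_near[OF assms(3,1)]] vf_near[OF assms(4,1)]]
  show ?thesis .
qed

lemma torsion_free:
  assumes "q \<in> W" "vf X" "vf Y"
  shows "br X Y q = tsub (nab X Y q) (nab Y X q)"
proof -
  have "\<forall>p. \<forall>X\<in>vfields_near A p. \<forall>Y\<in>vfields_near A p.
        tsub (D p (X p) Y) (D p (Y p) X) = lie_bracket A X Y p"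
    using levi_civita unfolding levi_civita_def by (elim conjE)
  from bspec[OF bspec[OF spec[OF this] vf_near[OF assms(2,1)]] vf_near[OF assms(3,1)]]
  show ?thesis by simp
qed

text \<open>Torsion-freeness identifies the bracket on \<open>W\<close> with a difference of two
  covariant derivatives, which are smooth fields.\<close>

lemma br_vf:
  assumes "vf X" "vf Y"
  shows "vf (br X Y)"
  by (rule vfield_on_cong[OF atlas vf_sub[OF nab_vf[OF assms] nab_vf[OF assms(2,1)]]])
    (simp add: torsion_free assms)

lemma deriv_cong:
  assumes "q \<in> W" "v \<in> T q" "smooth_on A W f" "\<And>r. r \<in> W \<Longrightarrow> f r = h r"
  shows "v f = v h"
  by (rule tangent_cong[OF assms(2) smooth_near[OF assms(3,1)]
        smooth_near[OF smooth_on_cong[OF atlas open_W assms(3,4)] assms(1)] eventually_W[OF assms(1,4)]])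

lemma deriv_add:
  assumes "q \<in> W" "v \<in> T q" "smooth_on A W f" "smooth_on A W h"
  shows "v (\<lambda>r. f r + h r) = v f + v h"
  by (rule tangent_add[OF assms(2) smooth_near[OF assms(3,1)] smooth_near[OF assms(4,1)]])

lemma deriv_minus:
  assumes "q \<in> W" "v \<in> T q" "smooth_on A W f" "smooth_on A W h" "\<And>r. r \<in> W \<Longrightarrow> h r = - f r"
  shows "v h = - v f"
proof -
  have "v h = v (\<lambda>r. - 1 * f r)"
    by (rule deriv_cong[OF assms(1,2,4)]) (simp add: assms(5))
  also have "\<dots> = - 1 * v f"
    by (rule tangent_scale[OF assms(2) smooth_near[OF assms(3,1)]])
  finally show ?thesis by simp
qed

subsection \<open>Curvature symmetries\<close>

definition R4 :: "'m vfield \<Rightarrow> 'm vfield \<Rightarrow> 'm vfield \<Rightarrow> 'm vfield \<Rightarrow> 'm \<Rightarrow> real" where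
  "R4 X Y Z V q = g q (curvature A D X Y Z q) (V q)"

lemma curvature_tangent:
  assumes "q \<in> W" "vf X" "vf Y" "vf Z"
  shows "curvature A D X Y Z q \<in> T q"
  unfolding curvature_def
  by (intro tsub_tangent D_tangent assms nab_vf vfield_onD[OF _ assms(1)] br_vf)

text \<open>The bracket stays whole here, for the arguments in which it acts as a derivation or
  enters the Jacobi identity; \<open>R4_expand\<close> resolves it by torsion-freeness.\<close>

lemma R4_br:
  assumes "q \<in> W" "vf X" "vf Y" "vf Z" "vf V"
  shows "R4 X Y Z V q = g q (nab X (nab Y Z) q) (V q) - g q (nab Y (nab X Z) q) (V q)
    - g q (nab (br X Y) Z q) (V q)"
  unfolding R4_def curvature_def
  by (simp add: g_sub_left tsub_tangent D_tangent nab_vf br_vf vfield_onD[OF _ assms(1)] assms)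

lemma nab_br:
  assumes "q \<in> W" "vf X" "vf Y" "vf Z"
  shows "nab (br X Y) Z q = tsub (nab (nab X Y) Z q) (nab (nab Y X) Z q)"
  by (simp add: torsion_free D_dir_sub D_tangent vfield_onD[OF _ assms(1)] assms)

lemma R4_expand:
  assumes "q \<in> W" "vf X" "vf Y" "vf Z" "vf V"
  shows "R4 X Y Z V q = g q (nab X (nab Y Z) q) (V q) - g q (nab Y (nab X Z) q) (V q)
    - g q (nab (nab X Y) Z q) (V q) + g q (nab (nab Y X) Z q) (V q)"
  unfolding R4_br[OF assms] nab_br[OF assms(1-4)]
  by (simp add: g_sub_left D_tangent nab_vf vfield_onD[OF _ assms(1)] assms)

lemma R4_skew12:
  assumes "q \<in> W" "vf X" "vf Y" "vf Z" "vf V"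
  shows "R4 X Y Z V q = - R4 Y X Z V q"
  unfolding R4_expand[OF assms] R4_expand[OF assms(1,3,2,4,5)] by simp

text \<open>Metric compatibility is used twice. The two mixed terms together are symmetric in
  \<open>X\<close> and \<open>Y\<close>, so they cancel in a commutator.\<close>

lemma second_deriv_metric:
  assumes "q \<in> W" "vf X" "vf Y" "vf Z" "vf V"
  shows "X q (\<lambda>r. Y r (ip Z V)) =
    g q (nab X (nab Y Z) q) (V q) + g q (nab Y Z q) (nab X V q) +
    g q (nab X Z q) (nab Y V q) + g q (Z q) (nab X (nab Y V) q)"
proof -
  note Xq = vfield_onD[OF assms(2,1)]
  have "X q (\<lambda>r. Y r (ip Z V)) = X q (\<lambda>r. ip (nab Y Z) V r + ip Z (nab Y V) r)"
    by (rule deriv_cong[OF assms(1) Xq vfield_on_smooth[OF assms(3) open_W order_refl ip_smooth[OF assms(4,5)]]])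
      (rule D_metric[OF _ vfield_onD[OF assms(3)] assms(4,5)])
  also have "\<dots> = X q (ip (nab Y Z) V) + X q (ip Z (nab Y V))"
    by (rule deriv_add[OF assms(1) Xq]) (intro ip_smooth nab_vf assms)+
  finally show ?thesis
    by (simp add: D_metric[OF assms(1) Xq] nab_vf assms)
qed

lemma br_apply:
  assumes "q \<in> W" "smooth_on A W f"
  shows "br X Y q f = X q (\<lambda>r. Y r f) - Y q (\<lambda>r. X r f)"
  using smooth_near[OF assms(2,1)] by (simp add: lie_bracket_def)

text \<open>The field [X,Y] acts on the function g(Z,V) in two ways: through metric compatibility
  and as the commutator of \<open>X\<close> and \<open>Y\<close>. The difference of the two is the
  sum of the two curvature terms.\<close>

lemma R4_skew34:
  assumes "q \<in> W" "vf X" "vf Y" "vf Z" "vf V"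
  shows "R4 X Y Z V q = - R4 X Y V Z q"
proof -
  have "g q (nab (br X Y) Z q) (V q) + g q (Z q) (nab (br X Y) V q) =
      X q (\<lambda>r. Y r (ip Z V)) - Y q (\<lambda>r. X r (ip Z V))"
    using D_metric[OF assms(1) vfield_onD[OF br_vf[OF assms(2,3)] assms(1)] assms(4,5)]
      br_apply[OF assms(1) ip_smooth[OF assms(4,5)], of X Y] by simp
  moreover have "g q (Z q) (nab U V q) = g q (nab U V q) (Z q)" if "vf U" "vf V" for U V
    by (intro g_sym D_tangent vfield_onD[OF _ assms(1)] assms that)
  ultimately show ?thesis
    unfolding R4_br[OF assms] R4_br[OF assms(1-3,5,4)]
      second_deriv_metric[OF assms] second_deriv_metric[OF assms(1,3,2,4,5)]
    by (simp add: nab_vf br_vf assms)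
qed

text \<open>Each double bracket expands into four third-order terms on a test function, and the
  cyclic sum cancels. The expansion is done on a neighbourhood \<open>N\<close> where the test
  function is smooth.\<close>

lemma jacobi:
  assumes "q \<in> W" "vf X" "vf Y" "vf Z"
  shows "tadd (tadd (br X (br Y Z) q) (br Y (br Z X) q)) (br Z (br X Y) q) = tzero"
proof
  fix f
  have expand: "br X (br Y Z) q f =
      X q (\<lambda>r. Y r (\<lambda>s. Z s f)) - X q (\<lambda>r. Z r (\<lambda>s. Y s f))
      - Y q (\<lambda>r. Z r (\<lambda>s. X s f)) + Z q (\<lambda>r. Y r (\<lambda>s. X s f))"
    if N: "open N" "q \<in> N" "N \<subseteq> W" "smooth_on A N f" and v: "vf X" "vf Y" "vf Z"
    for X Y Z N
  proof -
    have sm: "smooth_on A N (\<lambda>r. U r h)" if "vf U" "smooth_on A N h" for U h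
      by (rule vfield_on_smooth[OF that(1) N(1,3) that(2)])
    have near: "h \<in> smooth_near A r" if "smooth_on A N h" "r \<in> N" for h r
      by (rule smooth_nearI[OF that(1) N(1) that(2)])
    have br: "br U U' r h = U r (\<lambda>s. U' s h) - U' r (\<lambda>s. U s h)"
      if "smooth_on A N h" "r \<in> N" for U U' r h
      using near[OF that] by (simp add: lie_bracket_def)
    note Xq = vfield_onD[OF v(1) assms(1)]
    let ?YZ = "\<lambda>r. Y r (\<lambda>s. Z s f)" and ?ZY = "\<lambda>r. Z r (\<lambda>s. Y s f)"
    have smYZ: "smooth_on A N ?YZ" "smooth_on A N ?ZY"
      by (rule sm[OF v(2) sm[OF v(3) N(4)]], rule sm[OF v(3) sm[OF v(2) N(4)]])
    have smd: "smooth_on A N (\<lambda>r. ?YZ r - ?ZY r)"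
      by (rule smooth_on_diff[OF atlas N(1) smYZ])
    \<comment> \<open>The commutator formula for the inner bracket is available only on
      \<open>N\<close>, because of the guard in \<open>lie_bracket\<close>; locality of the
      derivation \<open>X q\<close> suffices.\<close>
    have "X q (\<lambda>r. br Y Z r f) = X q (\<lambda>r. ?YZ r - ?ZY r)"
    proof (rule tangent_cong[OF Xq])
      show "(\<lambda>r. br Y Z r f) \<in> smooth_near A q"
        by (rule near[OF sm[OF br_vf[OF v(2,3)] N(4)] N(2)])
      show "(\<lambda>r. ?YZ r - ?ZY r) \<in> smooth_near A q"
        by (rule near[OF smd N(2)])
      show "eventually (\<lambda>r. br Y Z r f = ?YZ r - ?ZY r) (nhds q)"
        unfolding eventually_nhds
        by (rule exI[of _ N], intro conjI ballI N(1,2), rule br[OF N(4)])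
    qed
    \<comment> \<open>Additivity for the sum of \<open>?YZ - ?ZY\<close> and
      \<open>?ZY\<close>.\<close>
    also have "\<dots> = X q ?YZ - X q ?ZY"
      using tangent_add[OF Xq near[OF smd N(2)] near[OF smYZ(2) N(2)]] by simp
    finally show ?thesis
      using br[OF N(4,2), of X "br Y Z"] br[OF sm[OF v(1) N(4)] N(2), of Y Z] by simp
  qed
  show "tadd (tadd (br X (br Y Z) q) (br Y (br Z X) q)) (br Z (br X Y) q) f = tzero f"
  proof (cases "f \<in> smooth_near A q")
    case True
    then obtain N where N: "open N" "q \<in> N" "smooth_on A N f"
      unfolding smooth_near_def by (elim CollectE exE conjE)
    have N': "open (N \<inter> W)" "q \<in> N \<inter> W" "N \<inter> W \<subseteq> W" "smooth_on A (N \<inter> W) f"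
      using N open_W assms(1) by (simp_all add: open_Int smooth_on_subset[OF N(3)])
    show ?thesis
      unfolding tadd_def tzero_def expand[OF N' assms(2-4)] expand[OF N' assms(3,4,2)]
        expand[OF N' assms(4,2,3)] by simp
  next
    \<comment> \<open>The guard makes all three outer brackets vanish on such a function.\<close>
    case False
    then show ?thesis by (simp add: tadd_def tzero_def lie_bracket_def)
  qed
qed

text \<open>Torsion-freeness, applied to both brackets of [X,[Y,Z]], gives three covariant
  derivative terms whose cyclic sum regroups into the cyclic sum of curvatures; the Jacobi identity
  makes it zero.\<close>

lemma bianchi:
  assumes "q \<in> W" "vf X" "vf Y" "vf Z" "vf V"
  shows "R4 X Y Z V q + R4 Y Z X V q + R4 Z X Y V q = 0"
proof -
  have br_br: "g q (br X (br Y Z) q) (V q) = g q (nab X (nab Y Z) q) (V q)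
      - g q (nab X (nab Z Y) q) (V q) - g q (nab (br Y Z) X q) (V q)"
    if "vf X" "vf Y" "vf Z" for X Y Z
  proof -
    note Xq = vfield_onD[OF that(1) assms(1)]
    have "nab X (br Y Z) q = D q (X q) (\<lambda>r. tsub (nab Y Z r) (nab Z Y r))"
      by (rule D_cong[OF assms(1) Xq br_vf[OF that(2,3)]]) (rule torsion_free[OF _ that(2,3)])
    also have "\<dots> = tsub (nab X (nab Y Z) q) (nab X (nab Z Y) q)"
      by (rule D_sub[OF assms(1) Xq]) (intro nab_vf that)+
    finally show ?thesis
      by (simp add: torsion_free[OF assms(1)] br_vf that g_sub_left tsub_tangent D_tangent nab_vf
          vfield_onD[OF _ assms(1)] assms(1,5))
  qed
  have "g q (tadd (tadd (br X (br Y Z) q) (br Y (br Z X) q)) (br Z (br X Y) q)) (V q) = 0"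
    unfolding jacobi[OF assms(1-4)] by (rule g_zero_left[OF vfield_onD[OF assms(5,1)]])
  then have "g q (br X (br Y Z) q) (V q) + g q (br Y (br Z X) q) (V q) + g q (br Z (br X Y) q) (V q) = 0"
    by (simp add: g_add_left tadd_tangent vfield_onD[OF _ assms(1)] br_vf assms)
  then show ?thesis
    by (simp add: br_br R4_br assms)
qed

text \<open>The four Bianchi identities, one for each field in the last slot, are combined with
  signs; skewness in the first and in the last pair cancels everything but twice the claimed
  difference.\<close>

lemma R4_pair:
  assumes "q \<in> W" "vf X" "vf Y" "vf Z" "vf V"
  shows "R4 X Y Z V q = R4 Z V X Y q"
  using bianchi[OF assms(1) assms(2,3,4,5)] bianchi[OF assms(1) assms(3,4,5,2)]
    bianchi[OF assms(1) assms(4,5,2,3)] bianchi[OF assms(1) assms(5,2,3,4)]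
    R4_skew34[OF assms(1) assms(3,4,5,2)] R4_skew34[OF assms(1) assms(4,5,3,2)]
    R4_skew12[OF assms(1) assms(5,3,4,2)]
    R4_skew12[OF assms(1) assms(5,2,4,3)] R4_skew34[OF assms(1) assms(2,5,4,3)]
    R4_skew12[OF assms(1) assms(2,4,5,3)] R4_skew34[OF assms(1) assms(4,2,5,3)]
    R4_skew12[OF assms(1) assms(5,2,3,4)] R4_skew34[OF assms(1) assms(2,3,5,4)]
    R4_skew34[OF assms(1) assms(3,5,2,4)]
  by linarith

subsection \<open>The covariant derivative of the structure tensor\<close>

definition psi :: "'m vfield \<Rightarrow> 'm vfield \<Rightarrow> 'm vfield \<Rightarrow> 'm \<Rightarrow> real" where
  "psi X Y Z q = g q (cov_deriv_11 D \<theta> q (X q) Y) (Z q)"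

definition nab_psi :: "'m vfield \<Rightarrow> 'm vfield \<Rightarrow> 'm vfield \<Rightarrow> 'm vfield \<Rightarrow> 'm \<Rightarrow> real" where
  "nab_psi U X Y Z q = U q (psi X Y Z) - psi (nab U X) Y Z q - psi X (nab U Y) Z q - psi X Y (nab U Z) q"

lemma cov_deriv_vf:
  assumes "vf X" "vf Y"
  shows "vf (\<lambda>q. cov_deriv_11 D \<theta> q (X q) Y)"
  unfolding cov_deriv_11_def by (intro vf_sub nab_vf th_vf assms)

lemma psi_smooth: "vf X \<Longrightarrow> vf Y \<Longrightarrow> vf Z \<Longrightarrow> smooth_on A W (psi X Y Z)"
  unfolding psi_def[abs_def] by (intro ip_smooth cov_deriv_vf)

text \<open>Skewness of \<theta> moves it from the derivative of \<open>Y\<close> onto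
  \<open>Z\<close>, which turns the minus sign of \<open>cov_deriv_11\<close> into a plus.\<close>

lemma psi_expand:
  assumes "q \<in> W" "vf X" "vf Y" "vf Z"
  shows "psi X Y Z q = g q (nab X (th Y) q) (Z q) + g q (nab X Y q) (th Z q)"
  unfolding psi_def cov_deriv_11_def
  by (simp add: g_sub_left theta_skew theta_tangent D_tangent th_vf vfield_onD[OF _ assms(1)] assms)

lemma psi_skew12:
  assumes "q \<in> W" "vf X" "vf Y" "vf Z"
  shows "psi X Y Z q = - psi Y X Z q"
proof -
  have "tadd (cov_deriv_11 D \<theta> q (X q) Y) (cov_deriv_11 D \<theta> q (Y q) X) = tzero"
    using bspec[OF bspec[OF spec[OF nearly] vf_near[OF assms(2,1)]] vf_near[OF assms(3,1)]] .
  moreover have "g q (tadd (cov_deriv_11 D \<theta> q (X q) Y) (cov_deriv_11 D \<theta> q (Y q) X)) (Z q) =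
      psi X Y Z q + psi Y X Z q"
    unfolding psi_def
    by (rule g_add_left[OF vfield_onD[OF cov_deriv_vf[OF assms(2,3)] assms(1)]
          vfield_onD[OF cov_deriv_vf[OF assms(3,2)] assms(1)] vfield_onD[OF assms(4,1)]])
  ultimately show ?thesis
    by (simp add: g_zero_left vfield_onD[OF assms(4,1)])
qed

text \<open>This is the derivative of g(Y, \<theta> Z) = - g(\<theta> Y, Z) along \<open>X\<close>.
  With \<open>psi_skew12\<close> it makes \<open>psi\<close> a 3-form.\<close>

lemma psi_skew23:
  assumes "q \<in> W" "vf X" "vf Y" "vf Z"
  shows "psi X Y Z q = - psi X Z Y q"
proof -
  note Xq = vfield_onD[OF assms(2,1)]
  have "X q (ip Y (th Z)) = - X q (ip (th Y) Z)"
    by (rule deriv_minus[OF assms(1) Xq ip_smooth[OF th_vf[OF assms(3)] assms(4)]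
          ip_smooth[OF assms(3) th_vf[OF assms(4)]]])
      (simp add: theta_skew vfield_onD[OF assms(3)] vfield_onD[OF assms(4)])
  then show ?thesis
    unfolding psi_expand[OF assms] psi_expand[OF assms(1,2,4,3)]
    using D_metric[OF assms(1) Xq th_vf[OF assms(3)] assms(4)]
      D_metric[OF assms(1) Xq assms(3) th_vf[OF assms(4)]]
      g_sym[OF vfield_onD[OF assms(3,1)] D_tangent[OF assms(1) Xq th_vf[OF assms(4)]]]
      g_sym[OF vfield_onD[OF th_vf[OF assms(3)] assms(1)] D_tangent[OF assms(1) Xq assms(4)]]
    by simp
qed

text \<open>Covariant differentiation preserves the symmetries of a tensor: each of the four terms
  changes sign under the swap.\<close>

lemma nab_psi_skew12:
  assumes "q \<in> W" "vf U" "vf X" "vf Y" "vf Z"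
  shows "nab_psi U X Y Z q = - nab_psi U Y X Z q"
proof -
  have "U q (psi X Y Z) = - U q (psi Y X Z)"
    by (rule deriv_minus[OF assms(1) vfield_onD[OF assms(2,1)] psi_smooth psi_smooth psi_skew12])
      (simp_all add: assms)
  then show ?thesis
    unfolding nab_psi_def
    using psi_skew12[OF assms(1) nab_vf[OF assms(2,3)] assms(4,5)]
      psi_skew12[OF assms(1,3) nab_vf[OF assms(2,4)] assms(5)]
      psi_skew12[OF assms(1,3,4) nab_vf[OF assms(2,5)]] by simp
qed

lemma nab_psi_skew23:
  assumes "q \<in> W" "vf U" "vf X" "vf Y" "vf Z"
  shows "nab_psi U X Y Z q = - nab_psi U X Z Y q"
proof -
  have "U q (psi X Y Z) = - U q (psi X Z Y)"
    by (rule deriv_minus[OF assms(1) vfield_onD[OF assms(2,1)] psi_smooth psi_smooth psi_skew23])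
      (simp_all add: assms)
  then show ?thesis
    unfolding nab_psi_def
    using psi_skew23[OF assms(1) nab_vf[OF assms(2,3)] assms(4,5)]
      psi_skew23[OF assms(1,3) nab_vf[OF assms(2,4)] assms(5)]
      psi_skew23[OF assms(1,3,4) nab_vf[OF assms(2,5)]] by simp
qed

section \<open>The Ricci identity and its consequences for the curvature\<close>

lemma nab_psi_expand:
  assumes "q \<in> W" "vf U" "vf X" "vf Y" "vf Z"
  shows "nab_psi U X Y Z q =
    g q (nab U (nab X (th Y)) q) (Z q) - g q (nab U (th (nab X Y)) q) (Z q)
    - g q (nab (nab U X) (th Y) q) (Z q) - g q (nab (nab U X) Y q) (th Z q)
    - g q (nab X (th (nab U Y)) q) (Z q) - g q (nab X (nab U Y) q) (th Z q)"
proof -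
  let ?F = "\<lambda>r. cov_deriv_11 D \<theta> r (X r) Y"
  note Uq = vfield_onD[OF assms(2,1)]
  \<comment> \<open>The last summand is the correction term for \<open>Z\<close> in
    \<open>nab_psi\<close>, so after cancellation \<open>Z\<close> is not differentiated.\<close>
  have "U q (psi X Y Z) = g q (nab U ?F q) (Z q) + psi X Y (nab U Z) q"
    using D_metric[OF assms(1) Uq cov_deriv_vf[OF assms(3,4)] assms(5)]
    unfolding psi_def[abs_def] .
  moreover have "nab U ?F q = tsub (nab U (nab X (th Y)) q) (nab U (th (nab X Y)) q)"
    unfolding cov_deriv_11_def
    by (rule D_sub[OF assms(1) Uq nab_vf[OF assms(3) th_vf[OF assms(4)]] th_vf[OF nab_vf[OF assms(3,4)]]])
  ultimately show ?thesis
    unfolding nab_psi_def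
    by (simp add: psi_expand g_sub_left D_tangent nab_vf th_vf vfield_onD[OF _ assms(1)] assms)
qed

text \<open>In \<open>nab_psi_expand\<close> the two terms that differentiate \<theta> applied to a
  covariant derivative of \<open>Y\<close> are together symmetric in \<open>U\<close> and
  \<open>X\<close>. The other terms antisymmetrise to curvatures acting on \<theta> Y and on
  \<open>Y\<close>.\<close>

lemma ricci_identity:
  assumes "q \<in> W" "vf U" "vf X" "vf Y" "vf Z"
  shows "nab_psi U X Y Z q - nab_psi X U Y Z q = R4 U X (th Y) Z q + R4 U X Y (th Z) q"
  by (simp add: nab_psi_expand R4_expand th_vf assms)

text \<open>Put \<open>S(U,X;Y,Z) = R4 U X (\<theta>Y) Z + R4 U X Y (\<theta>Z)\<close>. By the Ricci identity and the skewness of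
  \<open>nab_psi\<close>, the sums \<open>S(U,X;Y,Z) + S(Y,Z;U,X)\<close>, \<open>S(U,Y;Z,X) + S(Z,X;U,Y)\<close> and
  \<open>S(U,Z;X,Y) + S(X,Y;U,Z)\<close> all equal the exterior derivative of \<open>psi\<close>, and their total is zero
  by the first Bianchi identity.\<close>

lemma theta_curvature:
  assumes "q \<in> W" "vf U" "vf X" "vf Y" "vf Z"
  shows "R4 U X (th Y) Z q + R4 U X Y (th Z) q + R4 Y Z (th U) X q + R4 Y Z U (th X) q = 0"
proof -
  \<comment> \<open>Skewness in the last pair puts \<theta> into the last slot of both terms, the
    shape in which \<open>B\<close> applies.\<close>
  have S: "nab_psi a b c d q - nab_psi b a c d q = R4 a b c (th d) q - R4 a b d (th c) q"
    if "vf a" "vf b" "vf c" "vf d" for a b c d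
    using ricci_identity[OF assms(1) that] R4_skew34[OF assms(1) that(1,2) th_vf[OF that(3)] that(4)]
    by simp
  note sk = nab_psi_skew12[OF assms(1)] nab_psi_skew23[OF assms(1)]
  have B: "R4 a b c (th d) q + R4 b c a (th d) q + R4 c a b (th d) q = 0"
    if "vf a" "vf b" "vf c" "vf d" for a b c d
    by (rule bianchi[OF assms(1) that(1-3) th_vf[OF that(4)]])
  note R12 = R4_skew12[OF assms(1) _ _ _ th_vf]
  \<comment> \<open>For each direction, skewness in the other three arguments leaves a single value
    up to sign; the representatives are \<open>nab_psi U X Y Z\<close>,
    \<open>nab_psi X U Y Z\<close>, \<open>nab_psi Y U X Z\<close> and
    \<open>nab_psi Z U X Y\<close>.\<close>
  have
    "nab_psi U Y Z X q = nab_psi U X Y Z q" "nab_psi U Z X Y q = nab_psi U X Y Z q"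
    "nab_psi X Y U Z q = - nab_psi X U Y Z q" "nab_psi X Z U Y q = nab_psi X U Y Z q"
    "nab_psi Y X U Z q = - nab_psi Y U X Z q" "nab_psi Y Z U X q = nab_psi Y U X Z q"
    "nab_psi Z X U Y q = - nab_psi Z U X Y q" "nab_psi Z Y U X q = - nab_psi Z U Y X q"
    "nab_psi Y U Z X q = - nab_psi Y U X Z q" "nab_psi Z U Y X q = - nab_psi Z U X Y q"
    using sk[OF assms(2,3,4,5)] sk[OF assms(2,4,3,5)] sk[OF assms(2,4,5,3)] sk[OF assms(2,3,5,4)]
      sk[OF assms(2,5,3,4)]
      sk[OF assms(3,4,2,5)] sk[OF assms(3,5,2,4)] sk[OF assms(3,2,5,4)] sk[OF assms(3,2,4,5)]
      sk[OF assms(4,3,2,5)] sk[OF assms(4,5,2,3)] sk[OF assms(4,2,3,5)] sk[OF assms(4,2,5,3)]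
      sk[OF assms(5,3,2,4)] sk[OF assms(5,4,2,3)] sk[OF assms(5,2,4,3)] sk[OF assms(5,2,3,4)]
    by linarith+
  note T = this
  note S6 = S[OF assms(2,3,4,5)] S[OF assms(4,5,2,3)] S[OF assms(2,4,5,3)] S[OF assms(5,3,2,4)]
    S[OF assms(2,5,3,4)] S[OF assms(3,4,2,5)]
  note B4 = B[OF assms(3,4,5,2)] B[OF assms(4,5,2,3)] B[OF assms(3,2,5,4)] B[OF assms(2,3,4,5)]
  note R3 = R12[OF assms(2,5,4,3)] R12[OF assms(2,3,5,4)] R12[OF assms(2,4,3,5)]
  \<comment> \<open>Three times the common value of the three sums is zero, so already the first sum
    vanishes.\<close>
  have "R4 U X Y (th Z) q - R4 U X Z (th Y) q + R4 Y Z U (th X) q - R4 Y Z X (th U) q = 0"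
    using T S6 B4 R3 by linarith
  then show ?thesis
    using R4_skew34[OF assms(1-3) th_vf[OF assms(4)] assms(5)]
      R4_skew34[OF assms(1,4,5) th_vf[OF assms(2)] assms(3)] by linarith
qed

text \<open>This is \<open>theta_curvature\<close> at U = \<xi>: the term with \<theta> \<xi> drops
  out, and pair symmetry brings the last term to the form with \<theta> on \<open>X\<close>.\<close>

lemma R4_xi_derivation:
  assumes "q \<in> W" "vf X" "vf Y" "vf Z"
  shows "R4 \<xi> (th X) Y Z q + R4 \<xi> X (th Y) Z q + R4 \<xi> X Y (th Z) q = 0"
proof -
  \<comment> \<open>The vanishing of \<theta> \<xi> can be used directly in the last slot, where
    \<open>R4\<close> is pointwise by definition.\<close>
  have "R4 Y Z (th \<xi>) X q = - R4 Y Z X (th \<xi>) q"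
    by (intro R4_skew34 assms th_vf xi_vf)
  also have "R4 Y Z X (th \<xi>) q = 0"
    unfolding R4_def theta_xi by (intro g_zero_right curvature_tangent assms)
  finally show ?thesis
    using theta_curvature[OF assms(1) xi_vf assms(2-4)]
      R4_pair[OF assms(1) xi_vf th_vf[OF assms(2)] assms(3,4)] by simp
qed

text \<open>The pointwise rule \<theta>^3 = -\<theta> is inserted in the last slot and carried to
  the third by skewness and to the second by pair symmetry.\<close>

lemma R4_th_th_th:
  assumes "q \<in> W" "vf X" "vf Y" "vf Z" "vf V"
  shows "R4 X Y Z (th (th (th V))) q = - R4 X Y Z (th V) q"
    and "R4 X Y (th (th (th V))) Z q = - R4 X Y (th V) Z q"
    and "R4 X (th (th (th V))) Y Z q = - R4 X (th V) Y Z q"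
proof -
  have *: "R4 a b c (th (th (th V))) q = - R4 a b c (th V) q" if "vf a" "vf b" "vf c" for a b c
    unfolding R4_def
    by (simp add: theta_cube vfield_onD[OF assms(5,1)] g_scale_right theta_tangent
        curvature_tangent that assms(1))
  note v1 = th_vf[OF assms(5)] and v3 = th_vf[OF th_vf[OF th_vf[OF assms(5)]]]
  show "R4 X Y Z (th (th (th V))) q = - R4 X Y Z (th V) q"
    by (rule *[OF assms(2-4)])
  show "R4 X Y (th (th (th V))) Z q = - R4 X Y (th V) Z q"
    using R4_skew34[OF assms(1-3) v3 assms(4)] R4_skew34[OF assms(1-3) v1 assms(4)]
      *[OF assms(2,3,4)] by simp
  show "R4 X (th (th (th V))) Y Z q = - R4 X (th V) Y Z q"
    using R4_pair[OF assms(1,2) v3 assms(3,4)] R4_pair[OF assms(1,2) v1 assms(3,4)]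
      *[OF assms(3,4,2)] by simp
qed

text \<open>On the complexified orthogonal complement of \<open>\<xi>\<close> the eigenvalues of \<open>\<theta>\<close> are the two
  square roots of \<open>-1\<close>. No sum of three of them vanishes, so the derivation identity
  forces the trilinear form to be zero there.\<close>

lemma R4_xi_theta_square:
  assumes "q \<in> W" "vf X" "vf Y" "vf Z"
  shows "R4 \<xi> (th (th X)) (th (th Y)) (th (th Z)) q = 0"
proof -
  note x1 = th_vf[OF assms(2)] and y1 = th_vf[OF assms(3)] and z1 = th_vf[OF assms(4)]
  note x2 = th_vf[OF x1] and y2 = th_vf[OF y1] and z2 = th_vf[OF z1]
  note cube = R4_th_th_th[OF assms(1)]
  \<comment> \<open>Let T(i,j,k) be the form on \<theta>^i X, \<theta>^j Y, \<theta>^k Z. The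
    derivation identity at (1,1,1) reads T(2,1,1) + T(1,2,1) + T(1,1,2) = 0. At (2,2,1), (2,1,2) and
    (1,2,2), after reducing cubes, it writes T(2,2,2) as each of the three sums of two of these
    terms. Adding gives 3 T(2,2,2) = 0.\<close>
  show ?thesis
    using R4_xi_derivation[OF assms(1) x1 y1 z1] R4_xi_derivation[OF assms(1) x2 y2 z1] R4_xi_derivation[OF assms(1) x2 y1 z2]
      R4_xi_derivation[OF assms(1) x1 y2 z2]
      cube(1)[OF xi_vf x2 y1 assms(4)] cube(1)[OF xi_vf x1 y2 assms(4)]
      cube(2)[OF xi_vf x2 z1 assms(3)] cube(2)[OF xi_vf x1 z2 assms(3)]
      cube(3)[OF xi_vf y2 z1 assms(2)] cube(3)[OF xi_vf y1 z2 assms(2)]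
    by linarith
qed

text \<open>Orthogonally to \<xi> the square of \<theta> is -1, so up to sign each argument may be
  replaced by its image under \<theta>^2, which leads to \<open>R4_xi_theta_square\<close>.\<close>

lemma R4_xi_horizontal:
  assumes "q \<in> W" "vf X" "vf Y" "vf Z"
    and "g q (X q) (\<xi> q) = 0" "g q (Y q) (\<xi> q) = 0" "g q (Z q) (\<xi> q) = 0"
  shows "R4 \<xi> X Y Z q = 0"
proof -
  \<comment> \<open>Orthogonality is assumed at \<open>q\<close> alone, so the replacement is made
    in the last slot; the chain below brings the three arguments there one after the other.\<close>
  have slot: "R4 a b c V q = - R4 a b c (th (th V)) q"
    if "vf a" "vf b" "vf c" "vf V" "g q (V q) (\<xi> q) = 0" for a b c V
  proof -
    have "th (th V) q = tscale (- 1) (V q)"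
      using theta_theta[OF vfield_onD[OF that(4) assms(1)]] that(5)
      by (simp add: tadd_def tscale_def)
    then show ?thesis
      unfolding R4_def
      by (simp add: g_scale_right curvature_tangent vfield_onD[OF _ assms(1)] that assms(1))
  qed
  let ?x = "th (th X)" and ?y = "th (th Y)" and ?z = "th (th Z)"
  note v = assms(1) xi_vf
  have x: "vf ?x" and y: "vf ?y" and z: "vf ?z"
    by (intro th_vf assms)+
  have "R4 \<xi> X Y Z q = - R4 \<xi> X Y ?z q"
    by (intro slot v assms)
  also have "R4 \<xi> X Y ?z q = - R4 \<xi> X ?z Y q"
    by (intro R4_skew34 v assms z)
  also have "R4 \<xi> X ?z Y q = - R4 \<xi> X ?z ?y q"
    by (intro slot v assms z)
  also have "R4 \<xi> X ?z ?y q = R4 ?z ?y \<xi> X q"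
    by (intro R4_pair v assms z y)
  also have "R4 ?z ?y \<xi> X q = - R4 ?z ?y \<xi> ?x q"
    by (intro slot v assms z y)
  also have "R4 ?z ?y \<xi> ?x q = R4 \<xi> ?x ?z ?y q"
    by (intro R4_pair v z y x)
  also have "R4 \<xi> ?x ?z ?y q = 0"
    by (rule R4_xi_theta_square[OF assms(1,2,4,3)])
  finally show ?thesis by simp
qed

subsection \<open>The covariant derivative of the Reeb field\<close>

lemma nab_xi_perp:
  assumes "q \<in> W" "v \<in> T q"
  shows "g q (D q v \<xi>) (\<xi> q) = 0"
proof -
  have sm: "smooth_on A W (ip \<xi> \<xi>)" by (intro ip_smooth xi_vf)
  \<comment> \<open>The constant 1 is its own square, so the Leibniz rule forces its derivative to
    be zero.\<close>
  have "v (ip \<xi> \<xi>) = v (\<lambda>r. ip \<xi> \<xi> r * ip \<xi> \<xi> r)"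
    by (simp add: xi_unit)
  also have "\<dots> = v (ip \<xi> \<xi>) + v (ip \<xi> \<xi>)"
    using tangent_mult[OF assms(2) smooth_near[OF sm assms(1)] smooth_near[OF sm assms(1)]]
    by (simp add: xi_unit)
  finally show ?thesis
    using D_metric[OF assms xi_vf xi_vf] g_sym[OF D_tangent[OF assms xi_vf] xi_tangent] by simp
qed

text \<open>Put h = \<nabla>_\<xi> \<xi>. Since \<theta> \<xi> = 0, the identity
  \<open>psi \<xi> \<xi> (th h) = 0\<close> reads g(h, \<theta>^2 h) = 0, and \<theta>^2 h = -h
  because h is orthogonal to \<xi>.\<close>

lemma nab_xi_xi:
  assumes "q \<in> W"
  shows "D q (\<xi> q) \<xi> = tzero"
proof (rule g_definite)
  let ?h = "nab \<xi> \<xi>"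
  note h = D_tangent[OF assms xi_tangent xi_vf]
  have th_h: "vf (th ?h)" by (intro th_vf nab_vf xi_vf)
  show "D q (\<xi> q) \<xi> \<in> T q" by (fact h)
  have "psi \<xi> \<xi> (th ?h) q = 0"
    using psi_skew12[OF assms xi_vf xi_vf th_h] by simp
  moreover have "nab \<xi> (th \<xi>) q = tzero"
    by (rule D_zero[OF assms xi_tangent theta_xi])
  ultimately have "g q (?h q) (th (th ?h) q) = 0"
    using psi_expand[OF assms xi_vf xi_vf th_h] vfield_onD[OF th_h assms]
    by (simp add: g_zero_left)
  then show "g q (D q (\<xi> q) \<xi>) (D q (\<xi> q) \<xi>) = 0"
    by (simp add: theta_theta h nab_xi_perp assms xi_tangent g_add_right g_scale_right tscale_tangent)
qed

text \<open>For Y = \<theta> Z both \<theta>^2 Y = -Y and |\<theta> Y| = |Y| hold on all of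
  \<open>W\<close> and may be differentiated along \<xi>. They give
  \<open>psi \<xi> (th Y) Y = 0\<close>; swapping the first two arguments turns this into the
  claim.\<close>

lemma nab_xi_th:
  assumes "q \<in> W" "vf Z"
  shows "g q (nab (th (th Z)) \<xi> q) (th (th Z) q) = 0"
proof -
  let ?Y = "th Z"
  have Y: "vf ?Y" and Y1: "vf (th ?Y)"
    by (intro th_vf assms)+
  note q = assms(1)
  have flip: "r \<in> W \<Longrightarrow> th (th ?Y) r = tscale (- 1) (?Y r)" for r
    by (rule theta_cube[OF vfield_onD[OF assms(2)]])
  have "nab \<xi> (th (th ?Y)) q = tscale (- 1) (nab \<xi> ?Y q)"
    by (rule D_minus[OF q xi_tangent Y flip])
  then have 1: "g q (nab \<xi> (th (th ?Y)) q) (?Y q) = - g q (nab \<xi> ?Y q) (?Y q)"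
    by (simp add: g_scale_left D_tangent q xi_tangent Y vfield_onD[OF Y])
  have norm: "ip (th ?Y) (th ?Y) r = ip ?Y ?Y r" if "r \<in> W" for r
    using theta_skew[OF vfield_onD[OF Y that] vfield_onD[OF Y1 that]] flip[OF that]
    by (simp add: g_scale_right vfield_onD[OF Y that])
  have "\<xi> q (ip (th ?Y) (th ?Y)) = \<xi> q (ip ?Y ?Y)"
    by (rule deriv_cong[OF q xi_tangent ip_smooth[OF Y1 Y1] norm])
  then have 2: "g q (nab \<xi> (th ?Y) q) (th ?Y q) = g q (nab \<xi> ?Y q) (?Y q)"
    using D_metric[OF q xi_tangent Y1 Y1] D_metric[OF q xi_tangent Y Y]
      g_sym[OF vfield_onD[OF Y1 q] D_tangent[OF q xi_tangent Y1]]
      g_sym[OF vfield_onD[OF Y q] D_tangent[OF q xi_tangent Y]]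
    by simp
  have "psi \<xi> (th ?Y) ?Y q = 0"
    unfolding psi_expand[OF q xi_vf Y1 Y] using 1 2 by simp
  then have "psi (th ?Y) \<xi> ?Y q = 0"
    using psi_skew12[OF q xi_vf Y1 Y] by simp
  moreover have "nab (th ?Y) (th \<xi>) q = tzero"
    by (rule D_zero[OF q vfield_onD[OF Y1 q] theta_xi])
  ultimately show ?thesis
    using psi_expand[OF q Y1 xi_vf Y] by (simp add: g_zero_left vfield_onD[OF Y q])
qed

text \<open>This is the Killing equation for \<xi>. The quadratic form vanishes by splitting X into
  -\<theta>^2 X and a multiple of \<xi>, and skewness follows by polarisation.\<close>

lemma nab_xi_skew:
  assumes "q \<in> W" "vf X" "vf Y"
  shows "g q (nab X \<xi> q) (Y q) = - g q (nab Y \<xi> q) (X q)"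
proof -
  note q = assms(1)
  have diag: "g q (nab X \<xi> q) (X q) = 0" if "vf X" for X
  proof -
    let ?t = "th (th X)" and ?c = "g q (X q) (\<xi> q)"
    note Xq = vfield_onD[OF that q]
    have t: "?t q \<in> T q" by (intro theta_tangent Xq)
    have X: "X q = tadd (tscale (- 1) (?t q)) (tscale ?c (\<xi> q))"
      unfolding theta_theta[OF Xq] by (simp add: tadd_def tscale_def fun_eq_iff)
    have "nab X \<xi> q = tadd (tscale (- 1) (nab ?t \<xi> q)) (tscale ?c (D q (\<xi> q) \<xi>))"
      by (subst X) (simp only: D_dir_add D_dir_scale q t xi_tangent xi_vf tscale_tangent)
    also have "\<dots> = tscale (- 1) (nab ?t \<xi> q)"
      by (simp add: nab_xi_xi q tadd_def tscale_def tzero_def)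
    finally have "g q (nab X \<xi> q) (X q) = - g q (nab ?t \<xi> q) (X q)"
      by (simp add: g_scale_left D_tangent q t xi_vf Xq)
    \<comment> \<open>The second occurrence of \<open>X q\<close> is the metric argument; the first
      lies inside \<open>?t\<close>.\<close>
    also have "g q (nab ?t \<xi> q) (X q) = - g q (nab ?t \<xi> q) (?t q) + ?c * g q (nab ?t \<xi> q) (\<xi> q)"
      by (subst (2) X) (simp only: g_add_right g_scale_right tscale_tangent D_tangent q t xi_tangent xi_vf)
    also have "\<dots> = 0"
      using nab_xi_th[OF q that] nab_xi_perp[OF q t] by simp
    finally show ?thesis by simp
  qed
  \<comment> \<open>Polarisation with the difference X - Y.\<close>
  have "nab (\<lambda>r. tsub (X r) (Y r)) \<xi> q = tsub (nab X \<xi> q) (nab Y \<xi> q)"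
    by (rule D_dir_sub[OF q vfield_onD[OF assms(2) q] vfield_onD[OF assms(3) q] xi_vf])
  then have "g q (tsub (nab X \<xi> q) (nab Y \<xi> q)) (tsub (X q) (Y q)) = 0"
    using diag[OF vf_sub[OF assms(2,3)]] by simp
  then show ?thesis
    using diag[OF assms(2)] diag[OF assms(3)]
    by (simp add: g_sub_left g_sub_right tsub_tangent D_tangent xi_vf vfield_onD[OF _ q] assms)
qed

text \<open>Pair symmetry moves \<open>X\<close> to the last slot of R(\<xi>, \<nabla>_E \<xi>, E,
  X). When \<open>E\<close> is orthogonal to \<xi>, so are the other arguments apart from
  \<open>X\<close>, and only the \<xi> component of \<open>X\<close> survives.\<close>

lemma curvature_xi_reduce:
  assumes "q \<in> W" "vf E" "vf X" and E: "E q = \<xi> q \<or> g q (E q) (\<xi> q) = 0"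
  shows "R4 E X \<xi> (nab E \<xi>) q = g q (X q) (\<xi> q) * R4 E \<xi> \<xi> (nab E \<xi>) q"
proof -
  note q = assms(1)
  let ?h = "nab E \<xi>" and ?t = "th (th X)" and ?c = "g q (X q) (\<xi> q)"
  have h: "vf ?h" and t: "vf ?t" by (intro nab_vf th_vf xi_vf assms)+
  from E show ?thesis
  proof
    \<comment> \<open>Here \<nabla>_E \<xi> vanishes at \<open>q\<close>, and both sides are
      zero.\<close>
    assume "E q = \<xi> q"
    then have "R4 a b c ?h q = 0" if "vf a" "vf b" "vf c" for a b c
      unfolding R4_def
      by (simp add: nab_xi_xi q g_zero_right curvature_tangent that)
    then show ?thesis by (simp add: assms xi_vf)
  next
    assume "g q (E q) (\<xi> q) = 0"
    moreover have "g q (?h q) (\<xi> q) = 0"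
      by (rule nab_xi_perp[OF q vfield_onD[OF assms(2) q]])
    moreover have "g q (?t q) (\<xi> q) = 0"
      by (intro theta_perp_xi theta_tangent vfield_onD[OF assms(3) q])
    ultimately have 0: "R4 \<xi> ?h E ?t q = 0"
      by (intro R4_xi_horizontal q h t assms)
    have X: "X q = tadd (tscale (- 1) (?t q)) (tscale ?c (\<xi> q))"
      unfolding theta_theta[OF vfield_onD[OF assms(3) q]]
      by (simp add: tadd_def tscale_def fun_eq_iff)
    have "R4 \<xi> ?h E X q = - R4 \<xi> ?h E ?t q + ?c * R4 \<xi> ?h E \<xi> q"
      unfolding R4_def
      by (subst X) (simp only: g_add_right g_scale_right tscale_tangent curvature_tangent xi_tangent
          vfield_onD[OF t q] q xi_vf h assms(2))
    then show ?thesis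
      using 0 R4_pair[OF q assms(2,3) xi_vf h] R4_pair[OF q assms(2) xi_vf xi_vf h] by simp
  qed
qed

section \<open>Orthonormal expansion and the trace\<close>

lemma g_sum_right:
  assumes "finite I" "\<And>i. i \<in> I \<Longrightarrow> e i \<in> T q" "w \<in> T q"
  shows "(\<lambda>f. \<Sum>i\<in>I. c i * e i f) \<in> T q \<and>
    g q w (\<lambda>f. \<Sum>i\<in>I. c i * e i f) = (\<Sum>i\<in>I. c i * g q w (e i))"
  using assms(1,2)
\<comment> \<open>Membership is carried along because additivity of the metric in the induction step
  requires the partial sum to be tangent.\<close>
proof (induction I)
  case empty
  then show ?case
    using tzero_tangent[OF assms(3)] g_zero_right[OF assms(3)] by (simp add: tzero_def)
next
  case (insert j I)
  let ?s = "\<lambda>f. \<Sum>i\<in>I. c i * e i f"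
  have eq: "(\<lambda>f. \<Sum>i\<in>insert j I. c i * e i f) = tadd (tscale (c j) (e j)) ?s"
    using insert.hyps by (simp add: tadd_def tscale_def)
  have s: "?s \<in> T q" "g q w ?s = (\<Sum>i\<in>I. c i * g q w (e i))"
    using insert by simp_all
  have ej: "e j \<in> T q" using insert.prems by simp
  show ?case
    unfolding eq using insert.hyps s ej assms(3)
    by (simp add: tadd_tangent tscale_tangent g_add_right g_scale_right)
qed

lemma parseval:
  assumes e: "orthonormal_basis (g q) (T q) I e" and "w \<in> T q" "v \<in> T q"
  shows "g q w v = (\<Sum>j\<in>I. g q v (e j) * g q w (e j))"
proof -
  have fin: "finite I" and eT': "\<forall>i\<in>I. e i \<in> T q"
    and orth: "\<forall>i\<in>I. \<forall>j\<in>I. g q (e i) (e j) = (if i = j then 1 else 0)"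
    and span: "\<forall>v\<in>T q. \<exists>c. v = (\<lambda>f. \<Sum>i\<in>I. c i * e i f)"
    using e unfolding orthonormal_basis_def by - (elim conjE, assumption)+
  note eT = bspec[OF eT']
  obtain c where c: "v = (\<lambda>f. \<Sum>i\<in>I. c i * e i f)"
    using bspec[OF span assms(3)] by (rule exE)
  have coeff: "g q v (e j) = c j" if "j \<in> I" for j
  proof -
    have "g q v (e j) = g q (e j) v"
      by (rule g_sym[OF assms(3) eT[OF that]])
    also have "\<dots> = (\<Sum>i\<in>I. c i * g q (e j) (e i))"
      unfolding c using g_sum_right[OF fin eT eT[OF that], where c = c] by simp
    also have "\<dots> = (\<Sum>i\<in>I. if j = i then c i else 0)"
      by (rule sum.cong) (simp_all add: orth that)
    finally show ?thesis using fin that by simp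
  qed
  have "g q w v = (\<Sum>i\<in>I. c i * g q w (e i))"
    unfolding c using g_sum_right[OF fin eT assms(2), where c = c] by simp
  also have "\<dots> = (\<Sum>j\<in>I. g q v (e j) * g q w (e j))"
    by (rule sum.cong[OF refl]) (simp only: coeff)
  finally show ?thesis .
qed

text \<open>The sum is the trace of the product of the symmetric operator \<open>v \<mapsto> R(v,\<xi>)\<xi>\<close> with the
  skew-symmetric operator \<open>v \<mapsto> \<nabla>\<^sub>v\<xi>\<close>.\<close>

lemma trace_jacobi_operator:
  assumes "q \<in> W" "\<And>i. i \<in> I \<Longrightarrow> vf (E i)"
    and basis: "orthonormal_basis (g q) (T q) I (\<lambda>i. E i q)"
  shows "(\<Sum>i\<in>I. R4 (E i) \<xi> \<xi> (nab (E i) \<xi>) q) = 0"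
proof -
  note q = assms(1)
  define a where "a i j = g q (nab (E i) \<xi> q) (E j q) * R4 (E i) \<xi> \<xi> (E j) q" for i j
  have "R4 (E i) \<xi> \<xi> (nab (E i) \<xi>) q = (\<Sum>j\<in>I. a i j)" if "i \<in> I" for i
    unfolding a_def R4_def
    by (rule parseval[OF basis curvature_tangent[OF q assms(2)[OF that] xi_vf xi_vf]
          D_tangent[OF q vfield_onD[OF assms(2)[OF that] q] xi_vf]])
  then have sum: "(\<Sum>i\<in>I. R4 (E i) \<xi> \<xi> (nab (E i) \<xi>) q) = (\<Sum>i\<in>I. \<Sum>j\<in>I. a i j)"
    by (rule sum.cong[OF refl])
  \<comment> \<open>The entries of \<nabla>\<xi> are skew in the indices and those of
    R(_,\<xi>)\<xi> are symmetric.\<close>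
  have skew: "a i j = - a j i" if "i \<in> I" "j \<in> I" for i j
  proof -
    note Ei = assms(2)[OF that(1)] and Ej = assms(2)[OF that(2)]
    have "R4 (E i) \<xi> \<xi> (E j) q = R4 (E j) \<xi> \<xi> (E i) q"
      using R4_pair[OF q Ei xi_vf xi_vf Ej] R4_skew12[OF q xi_vf Ej Ei xi_vf]
        R4_skew34[OF q Ej xi_vf Ei xi_vf] by simp
    then show ?thesis
      unfolding a_def using nab_xi_skew[OF q Ei Ej] by simp
  qed
  have "(\<Sum>i\<in>I. \<Sum>j\<in>I. a i j) = (\<Sum>i\<in>I. \<Sum>j\<in>I. - a j i)"
    by (rule sum.cong[OF refl], rule sum.cong[OF refl], rule skew)
  also have "\<dots> = - (\<Sum>i\<in>I. \<Sum>j\<in>I. a i j)"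
    by (subst sum.swap) (simp only: sum_negf)
  finally show ?thesis unfolding sum by linarith
qed

lemma sum_nab_xi_curvature:
  assumes "q \<in> W" "\<And>i. i \<in> I \<Longrightarrow> vf (E i)" "vf X"
    and basis: "orthonormal_basis (g q) (T q) I (\<lambda>i. E i q)"
    and "k \<in> I" "E k q = \<xi> q"
  shows "(\<Sum>i\<in>I. g q (D q (E i q) \<xi>) (curvature A D (E i) X \<xi> q)) = 0"
proof -
  note q = assms(1)
  have "g q (D q (E i q) \<xi>) (curvature A D (E i) X \<xi> q) =
      g q (X q) (\<xi> q) * R4 (E i) \<xi> \<xi> (nab (E i) \<xi>) q" if "i \<in> I" for i
  proof -
    note Ei = assms(2)[OF that]
    \<comment> \<open>Orthonormality against the member \<open>E k\<close>, which is \<xi> at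
      \<open>q\<close>, yields the alternative required by
      \<open>curvature_xi_reduce\<close>.\<close>
    have "\<forall>i\<in>I. \<forall>j\<in>I. g q (E i q) (E j q) = (if i = j then 1 else 0)"
      using basis unfolding orthonormal_basis_def by (elim conjE)
    then have "g q (E i q) (E k q) = (if i = k then 1 else 0)"
      using that assms(5) by simp
    then have "E i q = \<xi> q \<or> g q (E i q) (\<xi> q) = 0"
      using assms(6) by (cases "i = k") simp_all
    from curvature_xi_reduce[OF q Ei assms(3) this]
    show ?thesis
      using g_sym[OF D_tangent[OF q vfield_onD[OF Ei q] xi_vf] curvature_tangent[OF q Ei assms(3) xi_vf]]
      by (simp add: R4_def)
  qed
  then have "(\<Sum>i\<in>I. g q (D q (E i q) \<xi>) (curvature A D (E i) X \<xi> q)) =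
      g q (X q) (\<xi> q) * (\<Sum>i\<in>I. R4 (E i) \<xi> \<xi> (nab (E i) \<xi>) q)"
    by (simp add: sum_distrib_left)
  then show ?thesis
    using trace_jacobi_operator[OF q assms(2) basis] by simp
qed

end

theorem proposition4p4:
  fixes A :: "('m::{t2_space, second_countable_topology}, 'e::euclidean_space) atlas"
    and \<theta> :: "'m endo_field" and \<xi> :: "'m vfield" and \<eta> :: "'m one_form"
    and g :: "'m metric" and D :: "'m connection"
    and n :: nat and p :: 'm and X :: "'m vfield" and E :: "nat \<Rightarrow> 'm vfield"
  assumes "smooth_atlas A" and "DIM('e) = 2 * n + 1"
    and "nearly_cosymplectic A \<theta> \<xi> \<eta> g D"
    and "X \<in> vfields_near A p"
    and "\<And>i. i \<in> {1..2 * n + 1} \<Longrightarrow> E i \<in> vfields_near A p"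
    and "orthonormal_basis (g p) (tangent_space A p) {1..2 * n + 1} (\<lambda>i. E i p)"
    and "orthonormal_basis (g p) (distribution_F A g \<xi> p) {1..2 * n} (\<lambda>i. E i p)"
    and "E (2 * n + 1) p = \<xi> p"
  shows "(\<Sum>i = 1..2 * n + 1. g p (D p (E i p) \<xi>) (curvature A D (E i) X \<xi> p)) = 0"
proof -
  let ?I = "{1..2 * n + 1}"
  have "\<forall>i\<in>?I. \<exists>W. open W \<and> p \<in> W \<and> vfield_on A W (E i)"
    using assms(5) unfolding vfields_near_def mem_Collect_eq by (rule ballI)
  then obtain U where U: "\<forall>i\<in>?I. open (U i) \<and> p \<in> U i \<and> vfield_on A (U i) (E i)"
    by (rule bchoice[THEN exE])
  obtain V where V: "open V" "p \<in> V" "vfield_on A V X"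
    using assms(4) unfolding vfields_near_def by (elim CollectE exE conjE)
  \<comment> \<open>The index set is finite, so the intersection of the domains of \<open>X\<close>
    and all \<open>E i\<close> is still an open neighbourhood of \<open>p\<close>.\<close>
  define W where "W = V \<inter> (\<Inter>i\<in>?I. U i)"
  have "open W" and p: "p \<in> W"
    unfolding W_def using U V by (simp_all add: open_Int open_INT)
  then interpret nearly_cosymplectic_on A \<theta> \<xi> \<eta> g D W
    by (intro nearly_cosymplectic_on.intro assms)
  show ?thesis
  proof (rule sum_nab_xi_curvature[OF p])
    show "vf (E i)" if "i \<in> ?I" for i
      by (rule vfield_on_subset[of A "U i"]) (use U that in \<open>auto simp: W_def\<close>)
    show "vf X"
      by (rule vfield_on_subset[OF V(3)]) (simp add: W_def)
    show "orthonormal_basis (g p) (T p) ?I (\<lambda>i. E i p)" by (fact assms(6))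
    show "2 * n + 1 \<in> ?I" by simp
    show "E (2 * n + 1) p = \<xi> p" by (fact assms(8))
  qed
qed

end
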